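(* $\mathcal{I}_{\mathrm{RDS}}\subset\mathcal{I}_{\mathrm{CF}}$; that is, the ideal of $(\mathcal{A}^0,ш)$ generated by the regularized double shuffle relations is contained in the module of confluence relations.
   Context: Let $\mathcal{A}_z=\mathbb{Z}\langle e_0,e_1,e_z\rangle$ be the free non-commutative (associative, unital) ring on formal symbols $e_0,e_1,e_z$, and $\mathcal{A}=\mathbb{Z}\langle e_0,e_1\rangle\subset\mathcal{A}_z$. Put $\mathcal{A}_z^0=\mathbb{Z}\oplus\mathbb{Z}e_z\oplus\bigoplus_{a\in\{1,z\},\,b\in\{0,z\}}e_a\mathcal{A}_ze_b$, $\mathcal{A}^0=\mathbb{Z}\oplus e_1\mathcal{A}e_0$, $\mathcal{A}_z^1=\mathbb{Z}\oplus e_1\mathcal{A}_z\oplus e_z\mathcal{A}_z$, $\mathcal{A}^1=\mathbb{Z}\oplus e_1\mathcal{A}$, $\mathcal{A}_z^{-2}=\mathbb{Z}\oplus e_1\mathcal{A}_ze_0\oplus e_z\mathcal{A}_ze_0$, and $\mathcal{A}_z^{-1}=\mathcal{A}_z^{-2}\,\mathbb{Z}\langle e_z\rangle$ (the span of concatenations $ue_z^k$, $u\in\mathcal{A}_z^{-2}$, $k\ge0$). Tensor products are over $\mathbb{Z}$. The shuffle product $ш$ on $\mathcal{A}_z$ is the bilinear product with $w\,ш\,1=1\,ш\,w=w$ and $e_au\,ш\,e_bv=e_a(u\,ш\,e_bv)+e_b(e_au\,ш\,v)$; $\mathcal{A}^0$, $\mathcal{A}^1$, $\mathcal{A}_z^0$,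 $\mathcal{A}_z^1$ are commutative rings under $ш$. The stuffle product $*:\mathcal{A}\times\mathcal{A}_z\to\mathcal{A}_z$ is the bilinear map with $u*1=u$, $1*v=v$ and $e_au*e_bv=e_{ab}(u*e_bv+e_au*v-e_0(u*v))$, where $ab$ is the product of the labels ($0\cdot b=0$, $a\cdot 0=0$, $1\cdot b=b$). For $w\in\mathcal{A}_z^1$, the shuffle regularization is $\mathrm{reg}_{ш}(w)=w_0\in\mathcal{A}_z^0$, where $w=\sum_{i=0}^{\deg w}w_i\,ш\,e_1^i$ is the unique such expression with $w_i\in\mathcal{A}_z^0$ ($e_1^i$ being the word $e_1\cdots e_1$). $\mathcal{I}_{\mathrm{RDS}}$ is the ideal of the ring $(\mathcal{A}^0,ш)$ generated by $\{\mathrm{reg}_{ш}(u\,ш\,v-u*v)\mid u\in\mathcal{A}^1,\ v\in\mathcal{A}^0\}$. For $\alpha,\beta\in\{0,1,z\}$ define the linear operator $\partial_{\alpha,\beta}$ on $\mathcal{A}_z$ by $\partial_{\alpha,\beta}(e_{a_1}\cdots e_{a_n})=\sum_{i=1}^n\left(\delta_{\{a_i,a_{i+1}\},\{\alpha,\beta\}}-\delta_{\{a_{i-1},a_i\},\{\alpha,\beta\}}\right)e_{a_1}\cdots\widehat{e_{a_i}}\cdots e_{a_n}$, where $a_0=0$, $a_{n+1}=1$, the hat denotes omission, and $\delta_{S,T}=1$ if $S=T$ as sets and $0$ otherwise. $\mathrm{Const}:\mathcal{A}_z\to\mathcal{A}$ is the linear map sending a word to itself if it contains no letter $e_z$, and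 to $0$ otherwise. The set of standard relations is $\mathcal{I}_{\mathrm{ST}}=\{w\in\mathcal{A}_z^0\mid \mathrm{Const}(\partial_{z,\alpha_1}\cdots\partial_{z,\alpha_r}w)=0\text{ for all }r\ge0\text{ and }\alpha_1,\dots,\alpha_r\in\{0,1\}\}$. The duality map $\tau_z$ is the anti-automorphism of the ring $\mathcal{A}_z$ with $\tau_z(e_0)=e_z-e_1$, $\tau_z(e_1)=e_z-e_0$, $\tau_z(e_z)=e_z$. The map $u\otimes v\mapsto u\,ш\,v$ is an isomorphism $\mathcal{A}_z^{-2}\otimes(\mathcal{A}_z^0\cap\mathbb{Z}\langle e_1,e_z\rangle)\to\mathcal{A}_z^0$; let $\mathrm{reg}_{\{z,1\}}$ be its inverse. It is also an isomorphism $\mathcal{A}_z^{-2}\otimes\mathbb{Z}\langle e_z\rangle\to\mathcal{A}_z^{-1}$; let $\mathrm{reg}_{\{z\}}$ be its inverse. Define $N:\mathcal{A}_z^0\to\mathcal{A}_z^{-1}$ as the composition of $\mathrm{reg}_{\{z,1\}}$, then $\mathrm{id}\otimes\tau_z$ (which lands in $\mathcal{A}_z^{-2}\otimes(\mathcal{A}_z^0\cap\mathbb{Z}\langle e_0,e_z\rangle)$), then $u\otimes v\mapsto u\,ш\,v$. Define $\lambda:\mathcal{A}_z^0\to\mathcal{A}^0$ as the composition of $N$, then $\mathrm{reg}_{\{z\}}$, then $\mathrm{id}\otimes\mathrm{const}:\mathcal{A}_z^{-2}\otimes\mathbb{Z}\langle e_z\rangle\to\mathcal{A}_z^{-2}$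 (where $\mathrm{const}$ takes the constant term: $1\mapsto1$, $e_z^k\mapsto0$ for $k\ge1$), then $\lambda':\mathcal{A}_z^{-2}\to\mathcal{A}^0$, the restriction of the ring homomorphism replacing $e_z$ by $e_1$. The module of confluence relations is $\mathcal{I}_{\mathrm{CF}}=\{\lambda(w)\mid w\in\mathcal{I}_{\mathrm{ST}}\}\subset\mathcal{A}^0$. *)

theory Defs
  imports "HOL-Library.Poly_Mapping" "HOL-Algebra.Ideal"
begin

text \<open>Lists form a monoid under concatenation, so that finitely supported functions
  \<open>'a list \<Rightarrow>\<^sub>0 int\<close> with the library's convolution product are the free associative unital
  ring over \<open>'a\<close>.\<close>

instantiation list :: (type) monoid_add
begin

definition zero_list :: "'a list" where "zero_list = []"

definition plus_list :: "'a list \<Rightarrow> 'a list \<Rightarrow> 'a list" where "plus_list = (@)"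

instance
  by standard (simp_all add: zero_list_def plus_list_def)

end

datatype letter = L0 | L1 | Lz

type_synonym lword = "letter list"

type_synonym Az = "lword \<Rightarrow>\<^sub>0 int"

abbreviation gen :: "letter \<Rightarrow> Az" where "gen a \<equiv> frag_of [a]"

definition word_span :: "lword set \<Rightarrow> Az set"
  where "word_span W = {p. Poly_Mapping.keys p \<subseteq> W}"

definition free_on :: "letter set \<Rightarrow> Az set"
  where "free_on S = word_span (lists S)"

definition Az0 :: "Az set"
  where "Az0 = word_span ({[], [Lz]} \<union>
    {a # m @ [b] | a m b. a \<in> {L1, Lz} \<and> b \<in> {L0, Lz}})"

definition A0 :: "Az set"
  where "A0 = word_span ({[]} \<union> {L1 # m @ [L0] | m. m \<in> lists {L0, L1}})"

definition A1 :: "Az set"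
  where "A1 = word_span ({[]} \<union> {L1 # m | m. m \<in> lists {L0, L1}})"

definition Azm2 :: "Az set"
  where "Azm2 = word_span ({[]} \<union> {a # m @ [L0] | a m. a \<in> {L1, Lz}})"

definition bilinear_ext :: "(lword \<Rightarrow> lword \<Rightarrow> Az) \<Rightarrow> Az \<Rightarrow> Az \<Rightarrow> Az"
  where "bilinear_ext f p q = frag_extend (\<lambda>u. frag_extend (f u) q) p"

fun shuffle_word :: "lword \<Rightarrow> lword \<Rightarrow> Az" where
  "shuffle_word [] v = frag_of v"
| "shuffle_word u [] = frag_of u"
| "shuffle_word (a # u) (b # v) =
     gen a * shuffle_word u (b # v) + gen b * shuffle_word (a # u) v"

definition shuffle :: "Az \<Rightarrow> Az \<Rightarrow> Az"
  where "shuffle = bilinear_ext shuffle_word"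

text \<open>Labels are only ever multiplied with a left factor 0 or 1, because the first argument of
  the stuffle product ranges over words in \<open>L0\<close>, \<open>L1\<close>.\<close>

fun label_mult :: "letter \<Rightarrow> letter \<Rightarrow> letter" where
  "label_mult L0 b = L0"
| "label_mult L1 b = b"
| "label_mult Lz b = undefined"

fun stuffle_word :: "lword \<Rightarrow> lword \<Rightarrow> Az" where
  "stuffle_word [] v = frag_of v"
| "stuffle_word u [] = frag_of u"
| "stuffle_word (a # u) (b # v) =
     gen (label_mult a b) *
       (stuffle_word u (b # v) + stuffle_word (a # u) v - gen L0 * stuffle_word u v)"

definition stuffle :: "Az \<Rightarrow> Az \<Rightarrow> Az"
  where "stuffle = bilinear_ext stuffle_word"

definition word_deg :: "Az \<Rightarrow> nat"
  where "word_deg w = Max (insert 0 (length ` Poly_Mapping.keys w))"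

definition reg_sh :: "Az \<Rightarrow> Az"
  where "reg_sh w = (THE w0. \<exists>c :: nat \<Rightarrow> Az. (\<forall>i \<le> word_deg w. c i \<in> Az0) \<and>
    w = (\<Sum>i \<le> word_deg w. shuffle (c i) (gen L1 ^ i)) \<and> w0 = c 0)"

definition shuffle_ring :: "Az ring"
  where "shuffle_ring =
    \<lparr>carrier = A0, monoid.mult = shuffle, one = 1, ring.zero = 0, ring.add = (+)\<rparr>"

definition I_RDS :: "Az set"
  where "I_RDS =
    Idl\<^bsub>shuffle_ring\<^esub> {reg_sh (shuffle u v - stuffle u v) | u v. u \<in> A1 \<and> v \<in> A0}"

text \<open>With \<open>x = L0 # w @ [L1]\<close>, the entry \<open>x ! i\<close> is the label \<open>a\<^sub>i\<close> for all
  \<open>0 \<le> i \<le> length w + 1\<close>, including the two boundary labels.\<close>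

definition del_word :: "letter \<Rightarrow> letter \<Rightarrow> lword \<Rightarrow> Az"
  where "del_word \<alpha> \<beta> w = (let x = L0 # w @ [L1] in
    \<Sum>i = 1..length w.
      frag_cmul (of_bool ({x ! i, x ! (i + 1)} = {\<alpha>, \<beta>}) - of_bool ({x ! (i - 1), x ! i} = {\<alpha>, \<beta>}))
        (frag_of (take (i - 1) w @ drop i w)))"

definition del :: "letter \<Rightarrow> letter \<Rightarrow> Az \<Rightarrow> Az"
  where "del \<alpha> \<beta> = frag_extend (del_word \<alpha> \<beta>)"

definition Const :: "Az \<Rightarrow> Az"
  where "Const = frag_extend (\<lambda>w. if Lz \<in> set w then 0 else frag_of w)"

definition I_ST :: "Az set"
  where "I_ST = {w \<in> Az0. \<forall>as \<in> lists {L0, L1}. Const (foldr (del Lz) as w) = 0}"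

fun tau_letter :: "letter \<Rightarrow> Az" where
  "tau_letter L0 = gen Lz - gen L1"
| "tau_letter L1 = gen Lz - gen L0"
| "tau_letter Lz = gen Lz"

definition tau :: "Az \<Rightarrow> Az"
  where "tau = frag_extend (\<lambda>w. prod_list (map tau_letter (rev w)))"

text \<open>The tensor square of the free abelian group on words is the free abelian group on pairs
  of words, and if \<open>M\<close> and \<open>N\<close> are spanned by words, then \<open>M \<otimes> N\<close> is its subgroup spanned by
  the pairs of a word in \<open>M\<close> and a word in \<open>N\<close>.\<close>

type_synonym Az_tensor = "lword \<times> lword \<Rightarrow>\<^sub>0 int"

definition tensor_span :: "Az set \<Rightarrow> Az set \<Rightarrow> Az_tensor set"
  where "tensor_span M N =
    {t. \<forall>(u, v) \<in> Poly_Mapping.keys t. frag_of u \<in> M \<and> frag_of v \<in> N}"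

definition pure_tensor :: "Az \<Rightarrow> Az \<Rightarrow> Az_tensor"
  where "pure_tensor p q = frag_extend (\<lambda>u. frag_extend (\<lambda>v. frag_of (u, v)) q) p"

definition tensor_shuffle :: "Az_tensor \<Rightarrow> Az"
  where "tensor_shuffle = frag_extend (\<lambda>(u, v). shuffle (frag_of u) (frag_of v))"

definition reg_z1 :: "Az \<Rightarrow> Az_tensor"
  where "reg_z1 = the_inv_into (tensor_span Azm2 (Az0 \<inter> free_on {L1, Lz})) tensor_shuffle"

definition reg_z :: "Az \<Rightarrow> Az_tensor"
  where "reg_z = the_inv_into (tensor_span Azm2 (free_on {Lz})) tensor_shuffle"

definition id_tensor_tau :: "Az_tensor \<Rightarrow> Az_tensor"
  where "id_tensor_tau = frag_extend (\<lambda>(u, v). pure_tensor (frag_of u) (tau (frag_of v)))"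

definition id_tensor_const :: "Az_tensor \<Rightarrow> Az"
  where "id_tensor_const = frag_extend (\<lambda>(u, v). if v = [] then frag_of u else 0)"

definition N_map :: "Az \<Rightarrow> Az"
  where "N_map = tensor_shuffle \<circ> id_tensor_tau \<circ> reg_z1"

definition z_to_1 :: "Az \<Rightarrow> Az"
  where "z_to_1 = frag_extend (\<lambda>w. frag_of (map (\<lambda>a. if a = Lz then L1 else a) w))"

definition conf_lambda :: "Az \<Rightarrow> Az"
  where "conf_lambda = z_to_1 \<circ> id_tensor_const \<circ> reg_z \<circ> N_map"

definition I_CF :: "Az set"
  where "I_CF = conf_lambda ` I_ST"

text \<open>\<open>shuffle_ring\<close> is indeed a commutative ring, so that \<open>Idl\<close> above is the generated ideal.\<close>

lemma frag_extend_plus_fun: "frag_extend (\<lambda>u. f u + g u) p = frag_extend f p + frag_extend g p"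
  by (simp add: frag_extend_def frag_cmul_distrib2 sum.distrib)

lemma frag_extend_diff_fun: "frag_extend (\<lambda>u. f u - g u) p = frag_extend f p - frag_extend g p"
proof -
  have "frag_extend (\<lambda>u. (f u - g u) + g u) p = frag_extend (\<lambda>u. f u - g u) p + frag_extend g p"
    by (rule frag_extend_plus_fun)
  then show ?thesis by simp
qed

lemma shuffle_add_left: "shuffle (p + q) r = shuffle p r + shuffle q r"
  by (simp add: shuffle_def bilinear_ext_def frag_extend_add)
lemma shuffle_add_right: "shuffle r (p + q) = shuffle r p + shuffle r q"
  by (simp add: shuffle_def bilinear_ext_def frag_extend_add frag_extend_plus_fun)
lemma shuffle_diff_left: "shuffle (p - q) r = shuffle p r - shuffle q r"
  by (simp add: shuffle_def bilinear_ext_def frag_extend_diff)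
lemma shuffle_diff_right: "shuffle r (p - q) = shuffle r p - shuffle r q"
  by (simp add: shuffle_def bilinear_ext_def frag_extend_diff frag_extend_diff_fun)
lemma shuffle_0 [simp]: "shuffle 0 r = 0" "shuffle r 0 = 0"
  using shuffle_diff_left[of 0 0 r] shuffle_diff_right[of r 0 0] by simp_all
lemma shuffle_of [simp]: "shuffle (frag_of u) (frag_of v) = shuffle_word u v"
  by (simp add: shuffle_def bilinear_ext_def)

lemma frag_ind [case_names zero of diff]:
  assumes "P 0" "\<And>x. P (frag_of x)" "\<And>a b. P a \<Longrightarrow> P b \<Longrightarrow> P (a - b)"
  shows "P p"
  by (rule frag_induction[of _ UNIV]) (use assms in auto)

lemma shuffle_word_Nil2 [simp]: "shuffle_word u [] = frag_of u"
  by (cases u) auto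

lemma shuffle_word_comm: "shuffle_word u v = shuffle_word v u"
  by (induction u v rule: shuffle_word.induct) (auto simp: add.commute)

lemma shuffle_comm: "shuffle p q = shuffle q p"
proof (induction p rule: frag_ind)
  case (of u)
  show ?case
    by (induction q rule: frag_ind) (simp_all add: shuffle_word_comm shuffle_diff_left shuffle_diff_right)
qed (simp_all add: shuffle_diff_left shuffle_diff_right)

lemma one_Az: "(1::Az) = frag_of []"
  by (simp flip: single_one add: zero_list_def)

lemma shuffle_one [simp]: "shuffle 1 p = p" "shuffle p 1 = p"
proof -
  show "shuffle 1 p = p"
    by (induction p rule: frag_ind) (simp_all add: one_Az shuffle_diff_right)
  then show "shuffle p 1 = p" by (simp add: shuffle_comm)
qed

lemma gen_mult_of: "gen a * frag_of w = frag_of (a # w)"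
  by (simp add: mult_single plus_list_def)

lemma shuffle_gen_of: "shuffle (gen a * p) (frag_of (c # w)) =
   gen a * shuffle p (frag_of (c # w)) + gen c * shuffle (gen a * p) (frag_of w)"
  by (induction p rule: frag_ind)
    (simp_all add: gen_mult_of shuffle_diff_left right_diff_distrib)

lemma shuffle_gen_gen: "shuffle (gen a * p) (gen c * q) =
   gen a * shuffle p (gen c * q) + gen c * shuffle (gen a * p) q"
  by (induction q rule: frag_ind)
    (simp_all add: gen_mult_of shuffle_gen_of shuffle_diff_right right_diff_distrib)

lemma shuffle_word_assoc:
  "shuffle (shuffle_word u v) (frag_of w) = shuffle (frag_of u) (shuffle_word v w)"
proof (induction "length u + length v + length w" arbitrary: u v w rule: less_induct)
  case less
  show ?case
  proof (cases "u = [] \<or> v = [] \<or> w = []")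
    case True
    then show ?thesis
      by (auto simp flip: one_Az)
  next
    case False
    then obtain a u' b v' c w' where [simp]: "u = a # u'" "v = b # v'" "w = c # w'"
      by (meson list.exhaust)
    have ih1: "shuffle (shuffle_word u' v) (frag_of w) = shuffle (frag_of u') (shuffle_word v w)"
      by (rule less) simp
    have ih2: "shuffle (shuffle_word u v') (frag_of w) = shuffle (frag_of u) (shuffle_word v' w)"
      by (rule less) simp
    have ih3: "shuffle (shuffle_word u v) (frag_of w') = shuffle (frag_of u) (shuffle_word v w')"
      by (rule less) simp
    have "shuffle (shuffle_word u v) (frag_of w) =
       gen a * shuffle (shuffle_word u' v) (frag_of w) + gen b * shuffle (shuffle_word u v') (frag_of w)
       + gen c * shuffle (shuffle_word u v) (frag_of w')"
      by (simp add: shuffle_add_left shuffle_gen_of distrib_left)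
    also have "\<dots> = gen a * shuffle (frag_of u') (shuffle_word v w) + gen b * shuffle (frag_of u) (shuffle_word v' w)
       + gen c * shuffle (frag_of u) (shuffle_word v w')"
      by (simp only: ih1 ih2 ih3)
    also have "\<dots> = shuffle (gen a * frag_of u') (shuffle_word v w)"
      by (simp add: shuffle_add_right shuffle_gen_gen distrib_left gen_mult_of[of a u', symmetric])
    finally show ?thesis by (simp add: gen_mult_of)
  qed
qed

lemma shuffle_assoc: "shuffle (shuffle p q) r = shuffle p (shuffle q r)"
proof (induction p rule: frag_ind)
  case (of u)
  show ?case
  proof (induction q rule: frag_ind)
    case (of v)
    show ?case
      by (induction r rule: frag_ind) (simp_all add: shuffle_word_assoc shuffle_diff_right)
  qed (simp_all add: shuffle_diff_left shuffle_diff_right)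
qed (simp_all add: shuffle_diff_left)

lemma keys_gen_mult: "Poly_Mapping.keys (gen a * p) \<subseteq> (#) a ` Poly_Mapping.keys p"
proof -
  have "Poly_Mapping.keys (gen a * p) \<subseteq> {x + y |x y. x \<in> Poly_Mapping.keys (gen a) \<and> y \<in> Poly_Mapping.keys p}"
    using keys_mult by blast
  then show ?thesis by (auto simp: plus_list_def)
qed

lemma keys_shuffle_word:
  "w \<in> Poly_Mapping.keys (shuffle_word u v) \<Longrightarrow>
    set w = set u \<union> set v \<and> length w = length u + length v \<and>
    (u \<noteq> [] \<longrightarrow> v \<noteq> [] \<longrightarrow> hd w \<in> {hd u, hd v} \<and> last w \<in> {last u, last v})"
proof (induction u v arbitrary: w rule: shuffle_word.induct)
  case (3 a u b v)
  from 3(3) have "w \<in> Poly_Mapping.keys (gen a * shuffle_word u (b # v)) \<union> Poly_Mapping.keys (gen b * shuffle_word (a # u) v)"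
    using Poly_Mapping.keys_add by fastforce
  then consider w' where "w = a # w'" "w' \<in> Poly_Mapping.keys (shuffle_word u (b # v))"
    | w' where "w = b # w'" "w' \<in> Poly_Mapping.keys (shuffle_word (a # u) v)"
    using keys_gen_mult by blast
  then show ?case
  proof cases
    case 1
    with 3(1)[of w'] show ?thesis by (cases "u = []"; cases "w' = []") (auto split: if_splits)
  next
    case 2
    with 3(2)[of w'] show ?thesis by (cases "v = []"; cases "w' = []") (auto split: if_splits)
  qed
qed auto

lemma A0_word: "w \<in> {[]} \<union> {L1 # m @ [L0] | m. m \<in> lists {L0, L1}} \<longleftrightarrow>
  w = [] \<or> w \<noteq> [] \<and> hd w = L1 \<and> last w = L0 \<and> set w \<subseteq> {L0, L1}"
proof
  assume "w = [] \<or> w \<noteq> [] \<and> hd w = L1 \<and> last w = L0 \<and> set w \<subseteq> {L0, L1}"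
  then consider "w = []" | x where "w = L1 # x" "last w = L0" "set w \<subseteq> {L0, L1}"
    by (metis list.collapse)
  then show "w \<in> {[]} \<union> {L1 # m @ [L0] | m. m \<in> lists {L0, L1}}"
  proof cases
    case 2
    then have "x \<noteq> []" by auto
    then have "x = butlast x @ [L0]"
      using 2 append_butlast_last_id[of x] by simp
    moreover have "butlast x \<in> lists {L0, L1}"
      using 2 by (auto dest: in_set_butlastD)
    ultimately show ?thesis using 2(1) by blast
  qed simp
qed auto

lemma A0_diff: "p \<in> A0 \<Longrightarrow> q \<in> A0 \<Longrightarrow> p - q \<in> A0"
  unfolding A0_def word_span_def using keys_diff[of p q] by blast
lemma A0_0: "0 \<in> A0" by (simp add: A0_def word_span_def)
lemma A0_add: "p \<in> A0 \<Longrightarrow> q \<in> A0 \<Longrightarrow> p + q \<in> A0"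
  using A0_diff[of p "0 - q"] A0_diff[of 0 q] A0_0 by simp

lemma A0_shuffle_word: "frag_of u \<in> A0 \<Longrightarrow> frag_of v \<in> A0 \<Longrightarrow> shuffle_word u v \<in> A0"
  unfolding A0_def word_span_def
  apply (simp only: mem_Collect_eq subset_iff A0_word keys_frag_of singleton_iff)
  apply (intro allI impI)
  subgoal for w
    using keys_shuffle_word[of w u v] by (cases "u = []"; cases "v = []") auto
  done

lemma A0_ind [consumes 1, case_names zero of diff]:
  assumes "p \<in> A0" "P 0" "\<And>x. frag_of x \<in> A0 \<Longrightarrow> P (frag_of x)" "\<And>a b. P a \<Longrightarrow> P b \<Longrightarrow> P (a - b)"
  shows "P p"
  by (rule frag_induction[of _ "{x. frag_of x \<in> A0}"]) (use assms in \<open>auto simp: A0_def word_span_def\<close>)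

lemma A0_shuffle: assumes "p \<in> A0" "q \<in> A0" shows "shuffle p q \<in> A0"
  using assms(1)
proof (induction p rule: A0_ind)
  case (of u)
  show ?case using assms(2)
    by (induction q rule: A0_ind) (use of in \<open>auto simp: A0_0 A0_diff shuffle_diff_right A0_shuffle_word\<close>)
qed (auto simp: A0_0 A0_diff shuffle_diff_left)

lemma one_in_A0: "1 \<in> A0"
  by (simp add: one_Az A0_def word_span_def)

lemma cring_shuffle_ring: "cring shuffle_ring"
proof (rule cringI)
  have neg: "\<exists>y\<in>A0. x + y = 0" if "x \<in> A0" for x
    using A0_diff[OF A0_0 that] by (intro bexI[of _ "- x"]) simp_all
  show "abelian_group shuffle_ring"
    by (rule abelian_groupI) (simp_all add: shuffle_ring_def A0_add A0_0 add_ac neg)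
  show "Group.comm_monoid shuffle_ring"
    by (rule comm_monoidI)
      (simp_all add: shuffle_ring_def A0_shuffle shuffle_assoc one_in_A0, rule shuffle_comm)
qed (auto simp: shuffle_ring_def shuffle_add_left)

end

theory Submission
  imports Defs
begin

text \<open>On \<open>Azm2\<close> the map \<open>conf_lambda\<close> is just the substitution of \<open>e\<^sub>1\<close> for \<open>e\<^sub>z\<close>, so it suffices to
  lift each generator of the ideal to a standard relation in \<open>Azm2\<close>. Given \<open>u \<in> A1\<close> and \<open>v \<in> A0\<close>,
  replace every \<open>e\<^sub>1\<close> in \<open>v\<close> by \<open>e\<^sub>z\<close> to get \<open>v'\<close>. The operators \<open>del Lz \<alpha>\<close> are shuffle derivations
  killing \<open>u\<close>, and they commute with the stuffle product by \<open>u\<close>; hence they map the defect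
  \<open>shuffle u v' - stuffle u v'\<close> to the defect of \<open>u\<close> and \<open>del Lz \<alpha> v'\<close>. All iterated derivatives of
  \<open>v'\<close> are combinations of words in \<open>e\<^sub>0, e\<^sub>z\<close> starting with \<open>e\<^sub>z\<close> and of the empty word, so \<open>Const\<close>
  kills the defects. Everything commutes with the expansion in shuffle powers of \<open>e\<^sub>1\<close>, whose
  coefficients here lie in \<open>Azm2\<close>, so the regularized defect is a standard relation in \<open>Azm2\<close>.
  Standard relations in \<open>Azm2\<close> are stable under shuffling with \<open>A0\<close>, which gives the whole ideal.\<close>

section \<open>Derivation property of the operators \<open>del Lz \<alpha>\<close>\<close>

text \<open>The Kronecker delta of \<open>del_word\<close>, taken in \<open>Az\<close> instead of
  the integers so that ring simplification can move it as a factor. Its only values are 0 and 1, so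
  it is central.\<close>

definition adj :: "letter \<Rightarrow> letter \<Rightarrow> letter \<Rightarrow> Az"
  where "adj \<alpha> a b = (if {a, b} = {Lz, \<alpha>} then 1 else 0)"

lemma adj_commute: "adj \<alpha> a b = adj \<alpha> b a"
  by (simp add: adj_def insert_commute)

text \<open>\<open>bdry_word \<alpha> c w\<close> is \<open>del_word Lz \<alpha> (c # w)\<close> without the contribution of the pair formed by \<open>c\<close> and
  the letter to its left. Unlike \<open>del_word\<close>, it satisfies a recursion that is linear in the tail.\<close>

fun bdry_word :: "letter \<Rightarrow> letter \<Rightarrow> lword \<Rightarrow> Az" where
  "bdry_word \<alpha> c [] = adj \<alpha> c L1"
| "bdry_word \<alpha> c (a # w) =
     adj \<alpha> c a * ((gen a - gen c) * frag_of w) + gen c * bdry_word \<alpha> a w"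

definition bdry :: "letter \<Rightarrow> letter \<Rightarrow> Az \<Rightarrow> Az"
  where "bdry \<alpha> c = frag_extend (bdry_word \<alpha> c)"

lemma bdry_simps [simp]:
  "bdry \<alpha> c 0 = 0" "bdry \<alpha> c (p + q) = bdry \<alpha> c p + bdry \<alpha> c q"
  "bdry \<alpha> c (p - q) = bdry \<alpha> c p - bdry \<alpha> c q"
  "bdry \<alpha> c 1 = adj \<alpha> c L1" "bdry \<alpha> c (frag_of w) = bdry_word \<alpha> c w"
  by (simp_all add: bdry_def frag_extend_add frag_extend_diff one_Az)

lemma bdry_gen_mult [simp]:
  "bdry \<alpha> c (gen a * p) = adj \<alpha> c a * ((gen a - gen c) * p) + gen c * bdry \<alpha> a p"
  by (induction p rule: frag_ind) (simp_all add: gen_mult_of right_diff_distrib)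

lemma del_simps [simp]:
  "del \<alpha> \<beta> 0 = 0" "del \<alpha> \<beta> (p + q) = del \<alpha> \<beta> p + del \<alpha> \<beta> q"
  "del \<alpha> \<beta> (p - q) = del \<alpha> \<beta> p - del \<alpha> \<beta> q"
  "del \<alpha> \<beta> (frag_of w) = del_word \<alpha> \<beta> w" "del \<alpha> \<beta> 1 = 0"
  by (simp_all add: del_def frag_extend_add frag_extend_diff one_Az del_word_def)

lemma del_word_Cons:
  "del_word Lz \<alpha> (a # w) = bdry_word \<alpha> a w - adj \<alpha> L0 a * frag_of w"
proof -
  \<comment> \<open>\<open>dw c\<close> is \<open>del_word\<close> with an arbitrary left boundary
    label c in place of 0; only this generality admits a recursion on the word.\<close>
  define dw where "dw c w = (\<Sum>i = 1..length w. let x = c # w @ [L1] in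
      (adj \<alpha> (x ! i) (x ! (i + 1)) - adj \<alpha> (x ! (i - 1)) (x ! i)) * frag_of (take (i - 1) w @ drop i w))"
    for c and w :: lword
  \<comment> \<open>The summand for i = 1 omits a; the others keep a in front, and a becomes the
    left boundary label of w.\<close>
  have dw_Cons: "dw c (a # w) =
      (adj \<alpha> a (hd (w @ [L1])) - adj \<alpha> c a) * frag_of w + gen a * dw a w" for c a w
  proof -
    have "dw c (a # w) = (let x = c # (a # w) @ [L1] in
        (adj \<alpha> (x ! 1) (x ! 2) - adj \<alpha> (x ! 0) (x ! 1)) * frag_of w)
      + (\<Sum>i = 1..length w. let x = c # (a # w) @ [L1] in
      (adj \<alpha> (x ! Suc i) (x ! (Suc i + 1)) - adj \<alpha> (x ! (Suc i - 1)) (x ! Suc i)) *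
         frag_of (take (Suc i - 1) (a # w) @ drop (Suc i) (a # w)))"
      unfolding dw_def
      by (subst sum.atLeast_Suc_atMost)
        (simp_all only: list.size add_0_right add_Suc_right sum.shift_bounds_cl_Suc_ivl Let_def,
          simp_all add: numeral_2_eq_2)
    also have "(\<Sum>i = 1..length w. let x = c # (a # w) @ [L1] in
      (adj \<alpha> (x ! Suc i) (x ! (Suc i + 1)) - adj \<alpha> (x ! (Suc i - 1)) (x ! Suc i)) *
         frag_of (take (Suc i - 1) (a # w) @ drop (Suc i) (a # w))) = gen a * dw a w"
      unfolding dw_def sum_distrib_left
    proof (rule sum.cong[OF refl])
      fix i assume "i \<in> {1..length w}"
      then obtain j where [simp]: "i = Suc j" by (cases i) auto
      have "(adj \<alpha> x y - adj \<alpha> x' y') * (gen a * p) = gen a * ((adj \<alpha> x y - adj \<alpha> x' y') * p)"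
        for x y x' y' p by (simp add: adj_def)
      then show "(let x = c # (a # w) @ [L1] in
      (adj \<alpha> (x ! Suc i) (x ! (Suc i + 1)) - adj \<alpha> (x ! (Suc i - 1)) (x ! Suc i)) *
         frag_of (take (Suc i - 1) (a # w) @ drop (Suc i) (a # w))) =
       gen a * (let x = a # w @ [L1] in
      (adj \<alpha> (x ! i) (x ! (i + 1)) - adj \<alpha> (x ! (i - 1)) (x ! i)) * frag_of (take (i - 1) w @ drop i w))"
        by (simp add: Let_def gen_mult_of[of a "take j w @ drop (Suc j) w", symmetric])
    qed
    finally show ?thesis
      by (cases w) (simp_all add: Let_def numeral_2_eq_2)
  qed
  \<comment> \<open>In \<open>bdry_word\<close> the omission of c counts only through its right
    neighbour, which is the first term; the second collects the omissions inside w.\<close>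
  have bdry_dw: "bdry_word \<alpha> c w = adj \<alpha> c (hd (w @ [L1])) * frag_of w + gen c * dw c w" for c w
  proof (induction w arbitrary: c)
    case Nil
    then show ?case by (simp add: dw_def flip: one_Az)
  next
    case (Cons a w)
    show ?case
      by (simp add: Cons dw_Cons adj_def algebra_simps gen_mult_of)
  qed
  have "del_word Lz \<alpha> w = dw L0 w" for w
    unfolding del_word_def dw_def Let_def
    by (rule sum.cong) (auto simp: adj_def)
  then show ?thesis
    by (simp add: dw_Cons bdry_dw algebra_simps)
qed

lemma del_gen_mult: "del Lz \<alpha> (gen a * p) = bdry \<alpha> a p - adj \<alpha> L0 a * p"
  by (induction p rule: frag_ind) (simp_all add: gen_mult_of del_word_Cons right_diff_distrib)

lemma shuffle_adj_mult:
  "shuffle (adj \<alpha> a b * p) q = adj \<alpha> a b * shuffle p q"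
  "shuffle p (adj \<alpha> a b * q) = adj \<alpha> a b * shuffle p q"
  by (auto simp: adj_def)

text \<open>Apart from the first term, the right-hand side is antisymmetric under exchanging \<open>(a, u)\<close> and
  \<open>(b, v)\<close>; this is why \<open>del Lz \<alpha>\<close> is a derivation.\<close>

lemma bdry_shuffle:
  "bdry \<alpha> a (shuffle (frag_of u) (gen b * frag_of v)) =
     shuffle (bdry \<alpha> a (frag_of u)) (gen b * frag_of v)
     + adj \<alpha> a b * ((gen b - gen a) * shuffle (frag_of u) (frag_of v))
     + gen a * shuffle (frag_of u) (bdry \<alpha> b (frag_of v))
     - gen b * shuffle (bdry \<alpha> a (frag_of u)) (frag_of v)"
proof (induction "length u + length v" arbitrary: a u b v rule: less_induct)
  case less
  show ?case
  proof (cases u)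
    case Nil
    have "shuffle (adj \<alpha> a L1) q = adj \<alpha> a L1 * q" for q by (auto simp: adj_def)
    then show ?thesis
      by (simp add: Nil adj_def algebra_simps flip: one_Az del: shuffle_of)
  next
    case (Cons x u')
    have u: "frag_of u = gen x * frag_of u'" by (simp add: Cons gen_mult_of)
    have Q1: "bdry \<alpha> x (shuffle (frag_of u') (gen b * frag_of v)) =
     shuffle (bdry \<alpha> x (frag_of u')) (gen b * frag_of v)
     + adj \<alpha> x b * ((gen b - gen x) * shuffle (frag_of u') (frag_of v))
     + gen x * shuffle (frag_of u') (bdry \<alpha> b (frag_of v))
     - gen b * shuffle (bdry \<alpha> x (frag_of u')) (frag_of v)"
      by (rule less) (simp add: Cons)
    \<comment> \<open>Induction on the total length makes the hypothesis available with the two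
      words exchanged as well.\<close>
    have "bdry \<alpha> b (shuffle (frag_of v) (gen x * frag_of u')) =
     shuffle (bdry \<alpha> b (frag_of v)) (gen x * frag_of u')
     + adj \<alpha> b x * ((gen x - gen b) * shuffle (frag_of v) (frag_of u'))
     + gen b * shuffle (frag_of v) (bdry \<alpha> x (frag_of u'))
     - gen x * shuffle (bdry \<alpha> b (frag_of v)) (frag_of u')"
      by (rule less) (simp add: Cons)
    then have Q2: "bdry \<alpha> b (shuffle (gen x * frag_of u') (frag_of v)) =
     shuffle (gen x * frag_of u') (bdry \<alpha> b (frag_of v))
     + adj \<alpha> x b * ((gen x - gen b) * shuffle (frag_of u') (frag_of v))
     + gen b * shuffle (bdry \<alpha> x (frag_of u')) (frag_of v)
     - gen x * shuffle (frag_of u') (bdry \<alpha> b (frag_of v))"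
      by (simp only: shuffle_comm[of "frag_of v"] shuffle_comm[of "bdry \<alpha> b (frag_of v)"] adj_commute[of \<alpha> b x])
    \<comment> \<open>All terms of \<open>Q1\<close> and \<open>Q2\<close> after the first are
      negatives of each other.\<close>
    have pair: "bdry \<alpha> x (shuffle (frag_of u') (gen b * frag_of v))
       + bdry \<alpha> b (shuffle (gen x * frag_of u') (frag_of v))
       = shuffle (bdry \<alpha> x (frag_of u')) (gen b * frag_of v)
       + shuffle (gen x * frag_of u') (bdry \<alpha> b (frag_of v))"
      unfolding Q1 Q2 by (simp add: algebra_simps)
    have "bdry \<alpha> a (shuffle (frag_of u) (gen b * frag_of v)) =
        adj \<alpha> a x * ((gen x - gen a) * shuffle (frag_of u') (gen b * frag_of v))
      + adj \<alpha> a b * ((gen b - gen a) * shuffle (gen x * frag_of u') (frag_of v))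
      + gen a * (bdry \<alpha> x (shuffle (frag_of u') (gen b * frag_of v))
          + bdry \<alpha> b (shuffle (gen x * frag_of u') (frag_of v)))"
      unfolding u shuffle_gen_gen bdry_simps bdry_gen_mult by (simp only: algebra_simps)
    also have "\<dots> = shuffle (bdry \<alpha> a (frag_of u)) (gen b * frag_of v)
     + adj \<alpha> a b * ((gen b - gen a) * shuffle (frag_of u) (frag_of v))
     + gen a * shuffle (frag_of u) (bdry \<alpha> b (frag_of v))
     - gen b * shuffle (bdry \<alpha> a (frag_of u)) (frag_of v)"
      unfolding pair u bdry_gen_mult
      by (cases "{a, x} = {Lz, \<alpha>}")
       (simp_all add: adj_def shuffle_add_left shuffle_diff_left shuffle_gen_gen left_diff_distrib
          right_diff_distrib distrib_left del: shuffle_of)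
    finally show ?thesis .
  qed
qed

text \<open>Each of the two terms of the shuffle recursion is evaluated by
  \<open>bdry_shuffle\<close>, once for each order of the factors, and the antisymmetric corrections
  cancel.\<close>

lemma del_shuffle_word:
  "del Lz \<alpha> (shuffle_word u v) = shuffle (del_word Lz \<alpha> u) (frag_of v) + shuffle (frag_of u) (del_word Lz \<alpha> v)"
proof (cases "u = [] \<or> v = []")
  case True
  then show ?thesis
    by (auto simp flip: one_Az simp: del_word_def)
next
  case False
  then obtain a u' b v' where uv: "u = a # u'" "v = b # v'"
    by (meson list.exhaust)
  note Q1 = bdry_shuffle[of \<alpha> a u' b v']
  have Q2: "bdry \<alpha> b (shuffle (gen a * frag_of u') (frag_of v')) =
     shuffle (gen a * frag_of u') (bdry \<alpha> b (frag_of v'))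
     + adj \<alpha> a b * ((gen a - gen b) * shuffle (frag_of u') (frag_of v'))
     + gen b * shuffle (bdry \<alpha> a (frag_of u')) (frag_of v')
     - gen a * shuffle (frag_of u') (bdry \<alpha> b (frag_of v'))"
    using bdry_shuffle[of \<alpha> b v' a u']
    by (simp only: shuffle_comm[of "frag_of v'"] shuffle_comm[of "bdry \<alpha> b (frag_of v')"] adj_commute[of \<alpha> b a])
  have "del Lz \<alpha> (shuffle (gen a * frag_of u') (gen b * frag_of v')) =
    shuffle (del Lz \<alpha> (gen a * frag_of u')) (gen b * frag_of v')
    + shuffle (gen a * frag_of u') (del Lz \<alpha> (gen b * frag_of v'))"
    unfolding shuffle_gen_gen del_gen_mult del_simps Q1 Q2 shuffle_diff_left shuffle_diff_right shuffle_adj_mult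
    by (simp only: algebra_simps)
  then show ?thesis by (simp add: uv gen_mult_of)
qed

lemma del_shuffle: "del Lz \<alpha> (shuffle p q) = shuffle (del Lz \<alpha> p) q + shuffle p (del Lz \<alpha> q)"
proof (induction p rule: frag_ind)
  case (of u)
  show ?case
    by (induction q rule: frag_ind) (simp_all add: del_shuffle_word shuffle_diff_right)
qed (simp_all add: shuffle_diff_left)


section \<open>Commutation with the stuffle product\<close>

lemma adj_simps [simp]:
  "\<alpha> \<in> {L0, L1} \<Longrightarrow> adj \<alpha> Lz Lz = 0"
  "a \<noteq> Lz \<Longrightarrow> b \<noteq> Lz \<Longrightarrow> adj \<alpha> a b = 0"
  by (auto simp: adj_def doubleton_eq_iff)

lemma bdry_word_no_z: "set u \<subseteq> {L0, L1} \<Longrightarrow> c \<noteq> Lz \<Longrightarrow> bdry_word \<alpha> c u = 0"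
  by (induction u arbitrary: c) auto

lemma del_word_no_z: "set u \<subseteq> {L0, L1} \<Longrightarrow> del_word Lz \<alpha> u = 0"
  using del_simps(5)[of Lz \<alpha>] unfolding one_Az
  by (cases u) (auto simp: del_word_Cons bdry_word_no_z)

abbreviation stuffle_left :: "lword \<Rightarrow> Az \<Rightarrow> Az"
  where "stuffle_left u \<equiv> stuffle (frag_of u)"

lemma stuffle_left_simps [simp]:
  "stuffle_left u 0 = 0"
  "stuffle_left u (p + q) = stuffle_left u p + stuffle_left u q"
  "stuffle_left u (p - q) = stuffle_left u p - stuffle_left u q"
  "stuffle_left u (frag_of v) = stuffle_word u v"
  "stuffle_left u (- p) = - stuffle_left u p"
  by (simp_all add: stuffle_def bilinear_ext_def frag_extend_add frag_extend_diff frag_extend_minus)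

lemma stuffle_word_Nil2 [simp]: "stuffle_word u [] = frag_of u"
  by (cases u) auto

lemma stuffle_left_one [simp]: "stuffle_left u 1 = frag_of u"
  by (simp add: one_Az)

lemma stuffle_left_Nil [simp]: "stuffle_left [] p = p"
  by (induction p rule: frag_ind) simp_all

text \<open>By induction on v, the second and third terms of the stuffle recursion cancel.\<close>

lemma stuffle_word_L0_left: "stuffle_word (L0 # u) v = gen L0 * stuffle_word u v"
  by (induction v) (simp_all add: gen_mult_of)

lemma stuffle_left_L0 [simp]: "stuffle_left (L0 # u) p = gen L0 * stuffle_left u p"
  by (induction p rule: frag_ind) (simp_all add: stuffle_word_L0_left right_diff_distrib)

text \<open>Here the first and third terms of the recursion cancel, by induction on u.\<close>

lemma stuffle_word_L0_right:
  "set u \<subseteq> {L0, L1} \<Longrightarrow> stuffle_word u (L0 # v) = gen L0 * stuffle_word u v"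
  by (induction u) (auto simp: gen_mult_of)

lemma stuffle_left_gen_L0:
  "set u \<subseteq> {L0, L1} \<Longrightarrow> stuffle_left u (gen L0 * p) = gen L0 * stuffle_left u p"
  by (induction p rule: frag_ind) (simp_all add: gen_mult_of stuffle_word_L0_right right_diff_distrib)

lemma stuffle_left_L1_gen:
  "stuffle_left (L1 # u) (gen b * p) =
     gen b * (stuffle_left u (gen b * p) + stuffle_left (L1 # u) p - gen L0 * stuffle_left u p)"
  by (induction p rule: frag_ind) (simp_all add: gen_mult_of algebra_simps)

text \<open>The argument of \<open>bdry\<close> is the bracket in the recursion for the stuffle
  product of e_1 u and e_z v. Subtracting d times this bracket, as \<open>del_gen_mult\<close>
  demands, turns the claim into commutation of \<open>del Lz \<alpha>\<close> with the
  product.\<close>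

lemma bdry_stuffle:
  assumes \<alpha>: "\<alpha> \<in> {L0, L1}" and "set u \<subseteq> {L0, L1}" and "set v \<subseteq> {L0, Lz}"
  defines "d \<equiv> adj \<alpha> L0 Lz"
  shows "bdry \<alpha> Lz (stuffle_left u (gen Lz * frag_of v) + stuffle_left (L1 # u) (frag_of v)
             - gen L0 * stuffle_left u (frag_of v)) =
           stuffle_left (L1 # u) (bdry \<alpha> Lz (frag_of v))
             + d * (stuffle_left u (gen Lz * frag_of v) - gen L0 * stuffle_left u (frag_of v))"
proof -
  \<comment> \<open>\<open>I\<close> is the claim. It has to be proved together with \<open>II\<close> and \<open>III\<close>, by induction on \<open>u\<close> and
    then on \<open>v\<close>; the identity \<open>Y\<close> reduces \<open>I u v\<close> to \<open>II u v\<close> and \<open>III u v\<close>.\<close>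
  define I where "I u v \<longleftrightarrow> bdry \<alpha> Lz (stuffle_left u (gen Lz * frag_of v) + stuffle_left (L1 # u) (frag_of v)
             - gen L0 * stuffle_left u (frag_of v)) =
           stuffle_left (L1 # u) (bdry \<alpha> Lz (frag_of v))
             + d * (stuffle_left u (gen Lz * frag_of v) - gen L0 * stuffle_left u (frag_of v))" for u v
  define II where "II u v \<longleftrightarrow> bdry \<alpha> L0 (stuffle_left u (frag_of v)) = stuffle_left u (bdry \<alpha> L0 (frag_of v))" for u v
  define III where "III u v \<longleftrightarrow> bdry \<alpha> Lz (stuffle_left u (gen Lz * frag_of v)) =
           gen Lz * stuffle_left u (bdry \<alpha> Lz (frag_of v))
             + d * (stuffle_left u (gen Lz * frag_of v) - gen Lz * stuffle_left u (frag_of v))" for u v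
  define Y where "Y u v \<longleftrightarrow>
      bdry \<alpha> Lz (stuffle_left (L1 # u) (frag_of v)) - stuffle_left (L1 # u) (bdry \<alpha> Lz (frag_of v)) =
        gen Lz * stuffle_left u (bdry \<alpha> L0 (frag_of v) - bdry \<alpha> Lz (frag_of v))" for u v
  have d: "d = 0 \<or> d = 1" and dz: "adj \<alpha> Lz L0 = d"
    by (auto simp: d_def adj_def insert_commute)
  have d1: "adj \<alpha> Lz L1 = 0 \<or> adj \<alpha> Lz L1 = 1"
    by (auto simp: adj_def)
  have b0: "bdry \<alpha> L0 (gen L0 * p) = gen L0 * bdry \<alpha> L0 p" for p
    by simp
  have b0z: "bdry \<alpha> L0 (gen Lz * p) = d * ((gen Lz - gen L0) * p) + gen L0 * bdry \<alpha> Lz p" for p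
    by (simp add: d_def)
  have bz0: "bdry \<alpha> Lz (gen L0 * p) = d * ((gen L0 - gen Lz) * p) + gen Lz * bdry \<alpha> L0 p" for p
    by (simp add: dz)
  have bzz: "bdry \<alpha> Lz (gen Lz * p) = gen Lz * bdry \<alpha> Lz p" for p
    using \<alpha> by simp
  have I_if_Y: "I u v" if "Y u v" "II u v" "III u v" for u v
    using that d unfolding I_def II_def III_def Y_def
    by (auto simp: algebra_simps bz0 simp del: stuffle_left_simps(4) bdry_simps(5) bdry_gen_mult)
  have II_Nil: "II [] v" for v
    by (simp add: II_def)
  have II_0: "II (L0 # u) v" if "II u v" for u v
    using that by (simp add: II_def stuffle_word_L0_left)
  \<comment> \<open>Inner induction on v for fixed u: \<open>II (L1 # u)\<close> and
    \<open>Y u\<close> come from \<open>II (L1 # u)\<close> and \<open>I u\<close> for the tail of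
    v, and then \<open>II u\<close> and \<open>III u\<close> turn \<open>Y u\<close> into
    \<open>I u\<close>.\<close>
  have II_1: "II (L1 # u) v \<and> I u v"
    if u: "set u \<subseteq> {L0, L1}" and IIu: "\<And>v. set v \<subseteq> {L0, Lz} \<Longrightarrow> II u v"
      and IIIu: "\<And>v. set v \<subseteq> {L0, Lz} \<Longrightarrow> III u v" and v: "set v \<subseteq> {L0, Lz}" for u v
    using v
  proof (induction v)
    case Nil
    have "Y u []"
      unfolding Y_def using d1 u by (auto simp: bdry_word_no_z algebra_simps gen_mult_of)
    then have "I u []" using IIu[of "[]"] IIIu[of "[]"] I_if_Y by simp
    moreover have "II (L1 # u) []"
      unfolding II_def using u by (simp add: bdry_word_no_z)
    ultimately show ?case by blast
  next
    case (Cons b v)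
    then have IH: "II (L1 # u) v" "I u v" and v: "set v \<subseteq> {L0, Lz}" and b: "b = L0 \<or> b = Lz" by auto
    have u1: "set (L1 # u) \<subseteq> {L0, L1}" using u by simp
    have "II (L1 # u) (b # v) \<and> Y u (b # v)"
      using b
    proof
      assume [simp]: "b = L0"
      show ?thesis
        using IH d unfolding II_def I_def Y_def
        by (auto simp: gen_mult_of[of L0 v, symmetric] b0 bz0 stuffle_left_gen_L0[OF u] stuffle_left_gen_L0[OF u1]
             stuffle_left_L1_gen[of u Lz] algebra_simps simp del: stuffle_left_simps(4) bdry_simps(5) bdry_gen_mult)
    next
      assume [simp]: "b = Lz"
      \<comment> \<open>Expanding the product of e_1 u and e_z v produces the very bracket whose
        boundary \<open>I u v\<close> computes.\<close>
      note IH2 = IH(2)[unfolded I_def]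
      have "II (L1 # u) (Lz # v)"
        unfolding II_def gen_mult_of[of Lz v, symmetric] stuffle_left_L1_gen[of u Lz "frag_of v"] b0z IH2
        using d by (auto simp: stuffle_left_gen_L0[OF u1] stuffle_left_L1_gen[of u Lz] algebra_simps
            simp del: stuffle_left_simps(4) bdry_simps(5) bdry_gen_mult)
      moreover have "Y u (Lz # v)"
        unfolding Y_def gen_mult_of[of Lz v, symmetric] stuffle_left_L1_gen[of u Lz "frag_of v"] b0z bzz IH2
        using d by (auto simp: stuffle_left_gen_L0[OF u] stuffle_left_L1_gen[of u Lz] algebra_simps
            simp del: stuffle_left_simps(4) bdry_simps(5) bdry_gen_mult)
      ultimately show ?thesis by simp
    qed
    moreover have "II u (b # v)" "III u (b # v)"
      using IIu[OF Cons.prems] IIIu[OF Cons.prems] by auto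
    ultimately show ?case using I_if_Y by blast
  qed
  have III_Nil: "III [] v" for v
    unfolding III_def by (simp add: bzz)
  have "\<forall>v. set v \<subseteq> {L0, Lz} \<longrightarrow> I u v \<and> II u v \<and> III u v"
    using \<open>set u \<subseteq> {L0, L1}\<close>
  proof (induction u)
    case Nil
    then show ?case using II_1[of "[]"] II_Nil III_Nil by auto
  next
    case (Cons a u)
    then have u: "set u \<subseteq> {L0, L1}" and a: "a = L0 \<or> a = L1"
      and IH: "\<And>v. set v \<subseteq> {L0, Lz} \<Longrightarrow> I u v \<and> II u v \<and> III u v" by auto
    \<comment> \<open>For a = 0, \<open>III\<close> for the longer word follows from
      \<open>II u (Lz # v)\<close>; for a = 1 it follows from \<open>I u v\<close>.\<close>
    have "II (a # u) v \<and> III (a # u) v" if v: "set v \<subseteq> {L0, Lz}" for v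
      using a
    proof
      assume [simp]: "a = L0"
      have II: "II u (Lz # v)" using IH v by simp
      have "III (L0 # u) v"
        unfolding III_def stuffle_left_L0 bz0 II[unfolded II_def gen_mult_of[of Lz v, symmetric]] using d
        by (auto simp: b0z stuffle_left_gen_L0[OF u] algebra_simps
            simp del: stuffle_left_simps(4) bdry_simps(5) bdry_gen_mult)
      then show ?thesis using II_0 IH v by simp
    next
      assume [simp]: "a = L1"
      have I: "I u v" using IH v by simp
      have "III (L1 # u) v"
        unfolding III_def stuffle_left_L1_gen bzz I[unfolded I_def] using d
        by (auto simp: algebra_simps simp del: stuffle_left_simps(4) bdry_simps(5) bdry_gen_mult)
      then show ?thesis using II_1[of u v] u IH v by simp
    qed
    then show ?case using II_1[of "a # u"] Cons.prems by blast
  qed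
  then show ?thesis
    using \<open>set v \<subseteq> {L0, Lz}\<close> unfolding I_def by blast
qed

lemma del_stuffle_word:
  assumes "\<alpha> \<in> {L0, L1}" "set u \<subseteq> {L0, L1}" "u = [] \<or> hd u = L1"
    "set v \<subseteq> {L0, Lz}" "v = [] \<or> hd v = Lz"
  shows "del Lz \<alpha> (stuffle_word u v) = stuffle_left u (del_word Lz \<alpha> v)"
proof (cases "u = [] \<or> v = []")
  case True
  then show ?thesis
    using assms by (auto simp: del_word_no_z)
next
  case False
  then obtain u' v' where [simp]: "u = L1 # u'" "v = Lz # v'"
    using assms by (metis list.collapse)
  have "set u' \<subseteq> {L0, L1}" "set v' \<subseteq> {L0, Lz}" using assms by auto
  note I = bdry_stuffle[OF assms(1) this]
  have "del Lz \<alpha> (stuffle_left (L1 # u') (gen Lz * frag_of v')) = stuffle_left u (del Lz \<alpha> (gen Lz * frag_of v'))"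
    unfolding stuffle_left_L1_gen del_gen_mult I
    by (auto simp: adj_def algebra_simps)
  then show ?thesis by (simp add: gen_mult_of)
qed


section \<open>Triangularity of the shuffle product\<close>

text \<open>The length of the longest suffix over S. It measures the sense in which the
  concatenation is the leading word of a shuffle.\<close>

primrec tail_block :: "letter set \<Rightarrow> lword \<Rightarrow> nat" where
  "tail_block S [] = 0"
| "tail_block S (a # w) = (if set (a # w) \<subseteq> S then length (a # w) else tail_block S w)"

lemma tail_block_append:
  assumes "u = [] \<or> last u \<notin> S" "set v \<subseteq> S"
  shows "tail_block S (u @ v) = length v"
  using assms(1)
proof (induction u)
  case Nil
  then show ?case using assms(2) by (cases v) auto
next
  case (Cons a u)
  then have "\<not> set (a # u) \<subseteq> S" using last_in_set[of "a # u"] by auto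
  then have "tail_block S ((a # u) @ v) = tail_block S (u @ v)" by auto
  moreover have "u = [] \<or> last u \<notin> S" using Cons.prems by auto
  ultimately show ?case using Cons.IH by simp
qed

lemma in_keys_diff:
  "w \<in> Poly_Mapping.keys (p - q) \<Longrightarrow> w \<in> Poly_Mapping.keys p \<or> w \<in> Poly_Mapping.keys (q :: 'a \<Rightarrow>\<^sub>0 int)"
  using keys_diff[of p q] by blast

lemma in_keys_add:
  "w \<in> Poly_Mapping.keys (p + q) \<Longrightarrow> w \<in> Poly_Mapping.keys p \<or> w \<in> Poly_Mapping.keys (q :: 'a \<Rightarrow>\<^sub>0 int)"
  using Poly_Mapping.keys_add[of p q] by blast

lemma in_keys_gen_mult:
  "w \<in> Poly_Mapping.keys (gen a * p) \<Longrightarrow> \<exists>w'\<in>Poly_Mapping.keys p. w = a # w'"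
  using keys_gen_mult[of a p] by blast

text \<open>In any other interleaving some letter of v stands before the last letter of u, which is
  outside S and cuts it off from the final block. The subtraction also records that the
  concatenation arises exactly once.\<close>

lemma keys_shuffle_minus_append:
  assumes "u = [] \<or> last u \<notin> S" "set v \<subseteq> S"
    "w \<in> Poly_Mapping.keys (shuffle_word u v - frag_of (u @ v))"
  shows "tail_block S w < length v"
  using assms
proof (induction u v arbitrary: w rule: shuffle_word.induct)
  case (3 a u b v)
  have "shuffle_word (a # u) (b # v) - frag_of ((a # u) @ (b # v)) =
      gen a * (shuffle_word u (b # v) - frag_of (u @ b # v)) + gen b * shuffle_word (a # u) v"
    by (simp add: right_diff_distrib gen_mult_of)
  with 3(5) have "w \<in> Poly_Mapping.keys
      (gen a * (shuffle_word u (b # v) - frag_of (u @ b # v)) + gen b * shuffle_word (a # u) v)"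
    by (simp only:)
  then consider w' where "w = a # w'" "w' \<in> Poly_Mapping.keys (shuffle_word u (b # v) - frag_of (u @ b # v))"
    | w' where "w = b # w'" "w' \<in> Poly_Mapping.keys (shuffle_word (a # u) v)"
    by (meson in_keys_add in_keys_gen_mult)
  then show ?case
  proof cases
    case 1
    have u: "u = [] \<or> last u \<notin> S" using 3(3) by auto
    have less: "tail_block S w' < length (b # v)"
      by (rule 3(1)[OF u 3(4) 1(2)])
    \<comment> \<open>A word w' entirely over S would be its own block, at least as long as
      \<open>b # v\<close>. So w' has a letter outside S, and prepending a leaves the block
      unchanged.\<close>
    have "length w' = length u + length (b # v)"
      using 1(2) in_keys_diff[OF 1(2)] keys_shuffle_word[of w' u "b # v"] by auto
    moreover have "tail_block S w' = length w'" if "set w' \<subseteq> S" for w'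
      using tail_block_append[of "[]" S w'] that by simp
    ultimately have "\<not> set w' \<subseteq> S"
      using less by fastforce
    then show ?thesis using less 1 by simp
  next
    case 2
    \<comment> \<open>The letter b already stands before the last letter of \<open>a # u\<close>, so
      at most \<open>length v\<close> letters remain for the block; the concatenation of
      \<open>a # u\<close> and v attains this bound.\<close>
    have "last (a # u) \<in> set w'"
      using keys_shuffle_word[OF 2(2)] last_in_set[of "a # u"] by blast
    then have "\<not> set w' \<subseteq> S" using 3(3) by auto
    then have "tail_block S w = tail_block S w'" using 2 by simp
    moreover have "tail_block S w' \<le> length v"
    proof (cases "w' = (a # u) @ v")
      case True
      then show ?thesis using tail_block_append[OF 3(3), of v] 3(4) by simp
    next
      case False
      then have "w' \<in> Poly_Mapping.keys (shuffle_word (a # u) v - frag_of ((a # u) @ v))"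
        using 2(2) by (simp add: in_keys_iff lookup_minus lookup_single)
      then show ?thesis using 3(2)[of w'] 3(3,4) by auto
    qed
    ultimately show ?thesis by simp
  qed
qed auto

section \<open>Injectivity of the shuffle map on tensors\<close>

lemma tensor_shuffle_simps [simp]:
  "tensor_shuffle 0 = 0" "tensor_shuffle (s - t) = tensor_shuffle s - tensor_shuffle t"
  "tensor_shuffle (frag_of (u, v)) = shuffle_word u v"
  by (simp_all add: tensor_shuffle_def frag_extend_diff)

text \<open>Take a pair (u, v) of t with v of maximal length. By triangularity the coefficient of
  \<open>u @ v\<close> in the image is the coefficient of (u, v) in t, which is nonzero.\<close>

lemma tensor_shuffle_eq_0:
  assumes t: "\<And>u v. (u, v) \<in> Poly_Mapping.keys t \<Longrightarrow> (u = [] \<or> last u \<notin> S) \<and> set v \<subseteq> S"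
    and "tensor_shuffle t = 0"
  shows "t = 0"
proof (rule ccontr)
  assume "t \<noteq> 0"
  then have "Poly_Mapping.keys t \<noteq> {}" by simp
  then have "Max (length ` snd ` Poly_Mapping.keys t) \<in> length ` snd ` Poly_Mapping.keys t"
    by (intro Max_in) auto
  then obtain x where x: "x \<in> Poly_Mapping.keys t" "Max (length ` snd ` Poly_Mapping.keys t) = length (snd x)"
    by auto
  have x_max: "length (snd y) \<le> length (snd x)" if "y \<in> Poly_Mapping.keys t" for y
    unfolding x(2)[symmetric] using that by (intro Max_ge) auto
  obtain u v where uv: "x = (u, v)" by fastforce
  have good: "u = [] \<or> last u \<notin> S" "set v \<subseteq> S" using t x(1) uv by auto
  \<comment> \<open>The block of \<open>u @ v\<close> is too long for a non-leading word of another
    pair, and its length shows where to cut, so different pairs have different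
    concatenations.\<close>
  have other: "Poly_Mapping.lookup (shuffle_word u' v') (u @ v) = (if (u', v') = (u, v) then 1 else 0)"
    if "(u', v') \<in> Poly_Mapping.keys t" for u' v'
  proof -
    have good': "u' = [] \<or> last u' \<notin> S" "set v' \<subseteq> S" using t that by auto
    have "length v' \<le> length v" using x_max[OF that] uv by simp
    then have "\<not> tail_block S (u @ v) < length v'"
      by (simp add: tail_block_append[OF good])
    then have "u @ v \<notin> Poly_Mapping.keys (shuffle_word u' v' - frag_of (u' @ v'))"
      using keys_shuffle_minus_append[OF good'] by blast
    then have "Poly_Mapping.lookup (shuffle_word u' v') (u @ v) = Poly_Mapping.lookup (frag_of (u' @ v')) (u @ v)"
      by (simp add: in_keys_iff lookup_minus)
    moreover have "u @ v = u' @ v' \<longleftrightarrow> (u', v') = (u, v)"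
      using tail_block_append[OF good] tail_block_append[OF good'] by (metis Pair_inject append_eq_append_conv)
    ultimately show ?thesis by (simp add: lookup_single)
  qed
  have "Poly_Mapping.lookup (tensor_shuffle t) (u @ v) =
     (\<Sum>y\<in>Poly_Mapping.keys t.
        Poly_Mapping.lookup t y * Poly_Mapping.lookup (shuffle_word (fst y) (snd y)) (u @ v))"
    by (simp add: tensor_shuffle_def frag_extend_def lookup_sum case_prod_unfold)
  also have "\<dots> = (\<Sum>y\<in>Poly_Mapping.keys t. if y = x then Poly_Mapping.lookup t x else 0)"
    by (rule sum.cong) (use other uv in auto)
  also have "\<dots> = Poly_Mapping.lookup t x"
    using x(1) by simp
  finally show False
    using assms(2) x(1) by (simp add: in_keys_iff)
qed

definition tensor_word :: "lword \<Rightarrow> Az \<Rightarrow> Az_tensor"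
  where "tensor_word v = frag_extend (\<lambda>u. frag_of (u, v))"

lemma tensor_word_simps [simp]:
  "tensor_word v 0 = 0" "tensor_word v (frag_of u) = frag_of (u, v)"
  "tensor_word v (p - q) = tensor_word v p - tensor_word v q"
  by (simp_all add: tensor_word_def frag_extend_diff)

lemma id_tensor_const_simps [simp]:
  "id_tensor_const 0 = 0" "id_tensor_const (s - t) = id_tensor_const s - id_tensor_const t"
  "id_tensor_const (frag_of (u, v)) = (if v = [] then frag_of u else 0)"
  by (simp_all add: id_tensor_const_def frag_extend_diff)

lemma keys_tensor_word:
  "Poly_Mapping.keys (tensor_word v p) \<subseteq> (\<lambda>u. (u, v)) ` Poly_Mapping.keys p"
  using keys_frag_extend[of "\<lambda>u. frag_of (u, v)" p] by (auto simp: tensor_word_def)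

lemma tensor_shuffle_tensor_word: "tensor_shuffle (tensor_word v p) = shuffle p (frag_of v)"
  by (induction p rule: frag_ind) (simp_all add: shuffle_diff_left)

lemma id_tensor_const_tensor_word:
  "id_tensor_const (tensor_word v p) = (if v = [] then p else 0)"
  by (induction p rule: frag_ind) simp_all

lemma gen_power: "gen a ^ i = frag_of (replicate i a)"
  by (induction i) (simp_all add: gen_mult_of one_Az)

lemma tensor_shuffle_sum:
  "finite I \<Longrightarrow> tensor_shuffle (\<Sum>i\<in>I. t i) = (\<Sum>i\<in>I. tensor_shuffle (t i))"
  by (simp add: tensor_shuffle_def frag_extend_sum comp_def)

lemma id_tensor_const_sum:
  "finite I \<Longrightarrow> id_tensor_const (\<Sum>i\<in>I. t i) = (\<Sum>i\<in>I. id_tensor_const (t i))"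
  by (simp add: id_tensor_const_def frag_extend_sum comp_def)

text \<open>The sum is the image of the tensor pairing \<open>c i\<close> with the word of i letters
  e_1. Injectivity for S = {e_1} kills this tensor, and \<open>id_tensor_const\<close> reads off its
  component \<open>c 0\<close>.\<close>

lemma shuffle_L1_powers_eq_0:
  assumes c: "\<And>i. i \<le> n \<Longrightarrow> c i \<in> word_span {w. w = [] \<or> last w \<noteq> L1}"
    and "(\<Sum>i\<le>n. shuffle (c i) (gen L1 ^ i)) = 0"
  shows "c 0 = 0"
proof -
  define t where "t = (\<Sum>i\<le>n. tensor_word (replicate i L1) (c i))"
  have "tensor_shuffle t = 0"
    using assms(2) by (simp add: t_def tensor_shuffle_sum tensor_shuffle_tensor_word gen_power)
  moreover have "(u = [] \<or> last u \<notin> {L1}) \<and> set v \<subseteq> {L1}" if uv: "(u, v) \<in> Poly_Mapping.keys t" for u v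
  proof -
    obtain i where i: "i \<le> n" "(u, v) \<in> Poly_Mapping.keys (tensor_word (replicate i L1) (c i))"
      using uv keys_sum[of "\<lambda>i. tensor_word (replicate i L1) (c i)" "{..n}"] unfolding t_def by auto
    then have "u \<in> Poly_Mapping.keys (c i)" "v = replicate i L1"
      using keys_tensor_word[of "replicate i L1" "c i"] by auto
    then show ?thesis using c[OF i(1)] by (auto simp: word_span_def)
  qed
  ultimately have "t = 0" using tensor_shuffle_eq_0[of t "{L1}"] by blast
  moreover have "id_tensor_const t = c 0"
    by (simp add: t_def id_tensor_const_sum id_tensor_const_tensor_word)
  ultimately show ?thesis by simp
qed

lemma frag_of_in_word_span [simp]: "frag_of w \<in> word_span W \<longleftrightarrow> w \<in> W"
  by (simp add: word_span_def)

lemma frag_of_Azm2: "frag_of u \<in> Azm2 \<longleftrightarrow> u = [] \<or> hd u \<in> {L1, Lz} \<and> last u = L0"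
proof -
  have "u \<in> {a # m @ [L0] |a m. a \<in> {L1, Lz}}" if "u \<noteq> []" "hd u \<in> {L1, Lz}" "last u = L0"
  proof -
    obtain a x where [simp]: "u = a # x" using \<open>u \<noteq> []\<close> by (cases u) auto
    have "x \<noteq> []" using that by auto
    then have "x = butlast x @ [L0]" using that append_butlast_last_id[of x] by simp
    then show ?thesis using that by auto
  qed
  then show ?thesis by (cases "u = []") (auto simp: Azm2_def)
qed

lemma Azm2_word_span: "Azm2 = word_span {u. u = [] \<or> hd u \<in> {L1, Lz} \<and> last u = L0}"
  using frag_of_Azm2 unfolding Azm2_def frag_of_in_word_span by (simp add: word_span_def subset_iff)

text \<open>Nonempty words of \<open>Azm2\<close> end in e_0, so the single choice S = {e_1, e_z}
  serves \<open>reg_z1\<close> and \<open>reg_z\<close> alike.\<close>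

lemma inj_on_tensor_shuffle:
  assumes "N \<subseteq> free_on {L1, Lz}"
  shows "inj_on tensor_shuffle (tensor_span Azm2 N)"
proof (rule inj_onI)
  fix s t assume st: "s \<in> tensor_span Azm2 N" "t \<in> tensor_span Azm2 N" "tensor_shuffle s = tensor_shuffle t"
  have "s - t = 0"
  proof (rule tensor_shuffle_eq_0[where S = "{L1, Lz}"])
    fix u v assume "(u, v) \<in> Poly_Mapping.keys (s - t)"
    then have "frag_of u \<in> Azm2 \<and> frag_of v \<in> free_on {L1, Lz}"
      using st(1,2) assms in_keys_diff[of "(u, v)" s t] unfolding tensor_span_def by blast
    then show "(u = [] \<or> last u \<notin> {L1, Lz}) \<and> set v \<subseteq> {L1, Lz}"
      by (auto simp: frag_of_Azm2 free_on_def)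
  qed (use st in simp)
  then show "s = t" by simp
qed

text \<open>Both regularizations send w to the tensor of w with 1, and \<open>tau\<close> fixes 1,
  so \<open>N_map\<close> fixes w and only the substitution acts.\<close>

lemma conf_lambda_Azm2:
  assumes "w \<in> Azm2"
  shows "conf_lambda w = z_to_1 w"
proof -
  have inv: "the_inv_into (tensor_span Azm2 N) tensor_shuffle w = tensor_word [] w"
    if "N \<subseteq> free_on {L1, Lz}" "1 \<in> N" for N
  proof -
    have "tensor_word [] w \<in> tensor_span Azm2 N"
      using keys_tensor_word[of "[]" w] assms that(2)
      by (force simp: tensor_span_def one_Az Azm2_word_span word_span_def)
    moreover have "tensor_shuffle (tensor_word [] w) = w"
      by (simp add: tensor_shuffle_tensor_word flip: one_Az)
    ultimately show ?thesis
      using the_inv_into_f_f[OF inj_on_tensor_shuffle[OF that(1)]] by metis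
  qed
  have "1 \<in> Az0 \<inter> free_on {L1, Lz}" "1 \<in> free_on {Lz}" "free_on {Lz} \<subseteq> free_on {L1, Lz}"
    by (auto simp: Az0_def free_on_def one_Az) (auto simp: word_span_def)
  then have regs: "reg_z1 w = tensor_word [] w" "reg_z w = tensor_word [] w"
    unfolding reg_z1_def reg_z_def by (auto intro!: inv)
  have "id_tensor_tau (tensor_word [] p) = tensor_word [] p" for p
    by (induction p rule: frag_ind)
      (simp_all add: id_tensor_tau_def frag_extend_diff pure_tensor_def tau_def one_Az)
  then have "N_map w = w"
    by (simp add: N_map_def regs tensor_shuffle_tensor_word flip: one_Az)
  then show ?thesis
    by (simp add: conf_lambda_def regs id_tensor_const_tensor_word)
qed


section \<open>Stability under \<open>del Lz \<alpha>\<close> and \<open>Const\<close>\<close>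

lemma word_span_0 [simp]: "0 \<in> word_span W"
  by (simp add: word_span_def)

lemma word_span_diff: "p \<in> word_span W \<Longrightarrow> q \<in> word_span W \<Longrightarrow> p - q \<in> word_span W"
  using in_keys_diff[of _ p q] by (auto simp: word_span_def)

lemma word_span_add: "p \<in> word_span W \<Longrightarrow> q \<in> word_span W \<Longrightarrow> p + q \<in> word_span W"
  using in_keys_add[of _ p q] by (auto simp: word_span_def)

lemma word_span_mono: "V \<subseteq> W \<Longrightarrow> word_span V \<subseteq> word_span W"
  by (auto simp: word_span_def)

lemma word_span_gen_mult:
  "p \<in> word_span V \<Longrightarrow> (\<And>w. w \<in> V \<Longrightarrow> a # w \<in> W) \<Longrightarrow> gen a * p \<in> word_span W"
  unfolding word_span_def using in_keys_gen_mult[of _ a p] by blast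

lemma word_span_adj_mult: "p \<in> word_span W \<Longrightarrow> adj \<alpha> a b * p \<in> word_span W"
  by (simp add: adj_def)

lemma word_span_adj: "[] \<in> W \<Longrightarrow> adj \<alpha> a b \<in> word_span W"
  by (simp add: adj_def one_Az)

lemma word_span_frag_extend:
  "p \<in> word_span V \<Longrightarrow> (\<And>w. w \<in> V \<Longrightarrow> f w \<in> word_span W) \<Longrightarrow> frag_extend f p \<in> word_span W"
  unfolding word_span_def using keys_frag_extend[of f p] by blast

lemma word_span_induct [consumes 1, case_names zero of diff]:
  assumes "p \<in> word_span W" "P 0" "\<And>w. w \<in> W \<Longrightarrow> P (frag_of w)" "\<And>p q. P p \<Longrightarrow> P q \<Longrightarrow> P (p - q)"
  shows "P p"
  using assms(1)[unfolded word_span_def, simplified] assms(2-4) by (rule frag_induction)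

lemma shuffle_in_word_span:
  assumes "p \<in> word_span U" "q \<in> word_span V" "\<And>u v. u \<in> U \<Longrightarrow> v \<in> V \<Longrightarrow> shuffle_word u v \<in> word_span W"
  shows "shuffle p q \<in> word_span W"
  unfolding shuffle_def bilinear_ext_def
  by (intro word_span_frag_extend[OF assms(1)] word_span_frag_extend[OF assms(2)] assms(3))

lemma Azm2_diff: "p \<in> Azm2 \<Longrightarrow> q \<in> Azm2 \<Longrightarrow> p - q \<in> Azm2"
  by (simp add: Azm2_def word_span_diff)

lemma Azm2_0: "0 \<in> Azm2"
  by (simp add: Azm2_def)

lemma Azm2_subset_Az0: "Azm2 \<subseteq> Az0"
  unfolding Azm2_def Az0_def by (rule word_span_mono) auto

lemma A0_word_span: "A0 = word_span {w. w = [] \<or> hd w = L1 \<and> last w = L0 \<and> set w \<subseteq> {L0, L1}}"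
proof -
  have "{[]} \<union> {L1 # m @ [L0] |m. m \<in> lists {L0, L1}} =
      {w. w = [] \<or> hd w = L1 \<and> last w = L0 \<and> set w \<subseteq> {L0, L1}}"
  proof (rule Set.set_eqI)
    fix w :: lword
    show "w \<in> {[]} \<union> {L1 # m @ [L0] |m. m \<in> lists {L0, L1}} \<longleftrightarrow>
        w \<in> {w. w = [] \<or> hd w = L1 \<and> last w = L0 \<and> set w \<subseteq> {L0, L1}}"
      unfolding A0_word by auto
  qed
  then show ?thesis by (simp only: A0_def)
qed

lemma Azm2_shuffle_A0:
  assumes "p \<in> Azm2" "q \<in> A0"
  shows "shuffle p q \<in> Azm2"
  using assms unfolding Azm2_word_span A0_word_span
proof (rule shuffle_in_word_span)
  fix u v
  assume uv: "u \<in> {u. u = [] \<or> hd u \<in> {L1, Lz} \<and> last u = L0}"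
    "v \<in> {w. w = [] \<or> hd w = L1 \<and> last w = L0 \<and> set w \<subseteq> {L0, L1}}"
  have "w = [] \<or> hd w \<in> {L1, Lz} \<and> last w = L0" if "w \<in> Poly_Mapping.keys (shuffle_word u v)" for w
    using keys_shuffle_word[OF that] that uv by (cases "u = []"; cases "v = []") auto
  then show "shuffle_word u v \<in> word_span {u. u = [] \<or> hd u \<in> {L1, Lz} \<and> last u = L0}"
    unfolding word_span_def by blast
qed

text \<open>The class in which coefficients of an expansion in shuffle powers of e_1 are unique. It
  contains \<open>Az0\<close> and is stable under \<open>del Lz \<alpha>\<close> and
  \<open>Const\<close>.\<close>

definition not_ending_L1 :: "Az set"
  where "not_ending_L1 = word_span {w. w = [] \<or> last w \<noteq> L1}"

lemma Az0_subset_not_ending_L1: "Az0 \<subseteq> not_ending_L1"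
  unfolding Az0_def not_ending_L1_def by (rule word_span_mono) auto

text \<open>Omitting a last letter that follows an e_1 has coefficient zero: the right boundary
  label is 1 too, so the two deltas agree. Keeping the resulting words nonempty ensures that
  prefixing c does not alter their last letter.\<close>

lemma bdry_word_not_ending_L1:
  "w \<noteq> [] \<Longrightarrow> last w \<noteq> L1 \<Longrightarrow> bdry_word \<alpha> c w \<in> word_span {w. w \<noteq> [] \<and> last w \<noteq> L1}"
proof (induction w arbitrary: c)
  case (Cons a w)
  show ?case
  proof (cases "w = []")
    case True
    have a: "a \<noteq> L1" using True Cons.prems by simp
    have "gen c * adj \<alpha> a L1 = adj \<alpha> a L1 * gen c" by (simp add: adj_def)
    then have eq: "bdry_word \<alpha> c (a # w) = adj \<alpha> c a * (gen a - gen c) + adj \<alpha> a L1 * gen c"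
      by (simp add: True flip: one_Az)
    show ?thesis
    \<comment> \<open>For c = 1 the two occurrences of the word e_1 in \<open>eq\<close> cancel by
      symmetry of \<open>adj\<close>.\<close>
    proof (cases "c = L1")
      case True
      then have "bdry_word \<alpha> c (a # w) = adj \<alpha> c a * gen a"
        unfolding eq by (simp add: adj_commute[of \<alpha> a] right_diff_distrib)
      then show ?thesis using a by (simp add: word_span_adj_mult)
    next
      case False
      then show ?thesis unfolding eq using a
        by (intro word_span_add word_span_adj_mult word_span_diff) simp_all
    qed
  next
    case False
    then have "bdry_word \<alpha> a w \<in> word_span {w. w \<noteq> [] \<and> last w \<noteq> L1}"
      using Cons by simp
    then have "gen c * bdry_word \<alpha> a w \<in> word_span {w. w \<noteq> [] \<and> last w \<noteq> L1}"
      by (rule word_span_gen_mult) simp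
    then show ?thesis using False Cons.prems
      by (auto simp: left_diff_distrib gen_mult_of
          intro!: word_span_add word_span_adj_mult word_span_diff)
  qed
qed simp

lemma del_not_ending_L1:
  assumes "p \<in> not_ending_L1"
  shows "del Lz \<alpha> p \<in> not_ending_L1"
  using assms unfolding not_ending_L1_def del_def
proof (rule word_span_frag_extend)
  fix w assume w: "w \<in> {w. w = [] \<or> last w \<noteq> L1}"
  show "del_word Lz \<alpha> w \<in> word_span {w. w = [] \<or> last w \<noteq> L1}"
  proof (cases w)
    case Nil
    then show ?thesis by (simp add: del_word_def)
  next
    case (Cons a w')
    show ?thesis
    proof (cases "w' = []")
      case True
      then show ?thesis using Cons
        by (auto simp: del_word_Cons intro!: word_span_diff word_span_adj_mult word_span_adj)
    next
      case False
      then have "bdry_word \<alpha> a w' \<in> word_span {w. w \<noteq> [] \<and> last w \<noteq> L1}"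
        using w Cons by (intro bdry_word_not_ending_L1) auto
      then have "bdry_word \<alpha> a w' \<in> word_span {w. w = [] \<or> last w \<noteq> L1}"
        by (rule subsetD[OF word_span_mono, rotated]) auto
      then show ?thesis using False Cons w
        by (auto simp: del_word_Cons intro!: word_span_diff word_span_adj_mult)
    qed
  qed
qed

text \<open>The words that occur in iterated derivatives of the lift of an element of
  \<open>A0\<close>. The last letter is free because, for the pair {z, 0}, the derivative of e_z e_0
  is -e_z.\<close>

definition z_words :: "lword set"
  where "z_words = {w. (w = [] \<or> hd w = Lz) \<and> set w \<subseteq> {L0, Lz}}"

lemma bdry_word_z_letters:
  "set w \<subseteq> {L0, Lz} \<Longrightarrow> c \<in> {L0, Lz} \<Longrightarrow> bdry_word \<alpha> c w \<in> word_span {w. set w \<subseteq> {L0, Lz}}"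
proof (induction w arbitrary: c)
  case Nil
  then show ?case by (simp add: adj_def one_Az)
next
  case (Cons a w)
  then have "bdry_word \<alpha> a w \<in> word_span {w. set w \<subseteq> {L0, Lz}}" by simp
  then have "gen c * bdry_word \<alpha> a w \<in> word_span {w. set w \<subseteq> {L0, Lz}}"
    by (rule word_span_gen_mult) (use Cons.prems in auto)
  then show ?case using Cons.prems
    by (auto simp: left_diff_distrib gen_mult_of
          intro!: word_span_add word_span_adj_mult word_span_diff)
qed

text \<open>Omitting the leading e_z before an e_0 has coefficient zero, since the left boundary
  label is 0 too. Any other omission leaves a word that is empty or begins with e_z.\<close>

lemma del_z_words:
  assumes \<alpha>: "\<alpha> \<in> {L0, L1}" and p: "p \<in> word_span z_words"
  shows "del Lz \<alpha> p \<in> word_span z_words"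
  unfolding del_def
proof (rule word_span_frag_extend[OF p])
  fix v assume v: "v \<in> z_words"
  show "del_word Lz \<alpha> v \<in> word_span z_words"
  proof (cases "length v \<le> 1")
    case True
    with v have "v = [] \<or> v = [Lz]"
      by (cases v) (auto simp: z_words_def)
    then show ?thesis
      by (auto simp: del_word_Cons z_words_def del_word_no_z intro!: word_span_diff word_span_adj_mult word_span_adj)
  next
    case False
    then have "Suc (Suc 0) \<le> length v" by simp
    then obtain a w where [simp]: "v = Lz # a # w"
      using v unfolding Suc_le_length_iff z_words_def by auto
    have a: "a \<in> {L0, Lz}" and w: "set w \<subseteq> {L0, Lz}" using v by (auto simp: z_words_def)
    have b: "gen Lz * bdry_word \<alpha> a w \<in> word_span z_words"
      by (rule word_span_gen_mult[OF bdry_word_z_letters[OF w a]]) (auto simp: z_words_def)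
    have z: "frag_of (Lz # w) \<in> word_span z_words" using w by (auto simp: z_words_def)
    show ?thesis
      using a
    proof (elim insertE emptyE)
      assume [simp]: "a = L0"
      have "del_word Lz \<alpha> v = gen Lz * bdry_word \<alpha> a w - adj \<alpha> L0 Lz * frag_of (Lz # w)"
        by (simp add: del_word_Cons left_diff_distrib gen_mult_of right_diff_distrib adj_commute[of \<alpha> Lz])
      then show ?thesis using b z by (auto intro!: word_span_diff word_span_adj_mult)
    next
      assume [simp]: "a = Lz"
      have "del_word Lz \<alpha> v = gen Lz * bdry_word \<alpha> a w - adj \<alpha> L0 Lz * frag_of (Lz # w)"
        using \<alpha> by (simp add: del_word_Cons)
      then show ?thesis using b z by (auto intro!: word_span_diff word_span_adj_mult)
    qed
  qed
qed

section \<open>Iterated derivatives and constant parts\<close>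

lemma del_no_z: "a \<in> free_on {L0, L1} \<Longrightarrow> del Lz \<alpha> a = 0"
  unfolding free_on_def
  by (induction a rule: word_span_induct) (auto intro!: del_word_no_z)

lemma foldr_del_diff: "foldr (del Lz) as (p - q) = foldr (del Lz) as p - foldr (del Lz) as q"
  by (induction as) simp_all

lemma foldr_del_0: "foldr (del Lz) as 0 = 0"
  by (induction as) simp_all

lemma foldr_del_add: "foldr (del Lz) as (p + q) = foldr (del Lz) as p + foldr (del Lz) as q"
  by (induction as) simp_all

lemma foldr_del_sum: "finite I \<Longrightarrow> foldr (del Lz) as (\<Sum>i\<in>I. f i) = (\<Sum>i\<in>I. foldr (del Lz) as (f i))"
  by (induction I rule: finite_induct) (simp_all add: foldr_del_0 foldr_del_add)

lemma foldr_del_shuffle_no_z: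
  "a \<in> free_on {L0, L1} \<Longrightarrow> foldr (del Lz) as (shuffle p a) = shuffle (foldr (del Lz) as p) a"
  by (induction as) (simp_all add: del_shuffle del_no_z)

lemma Const_simps [simp]:
  "Const 0 = 0" "Const (p - q) = Const p - Const q"
  "Const (frag_of w) = (if Lz \<in> set w then 0 else frag_of w)"
  by (simp_all add: Const_def frag_extend_diff)

lemma Const_sum: "finite I \<Longrightarrow> Const (\<Sum>i\<in>I. f i) = (\<Sum>i\<in>I. Const (f i))"
  by (simp add: Const_def frag_extend_sum comp_def)

lemma Const_eq_0: "(\<And>w. w \<in> Poly_Mapping.keys p \<Longrightarrow> Lz \<in> set w) \<Longrightarrow> Const p = 0"
  unfolding Const_def by (rule frag_extend_eq_0) simp

lemma Const_eq_id:
  assumes "\<And>w. w \<in> Poly_Mapping.keys p \<Longrightarrow> Lz \<notin> set w"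
  shows "Const p = p"
proof -
  have "Const p = frag_extend frag_of p"
    unfolding Const_def by (rule frag_extend_eq) (use assms in simp)
  then show ?thesis by (simp flip: frag_expansion)
qed

lemma Const_shuffle: "Const (shuffle p q) = shuffle (Const p) (Const q)"
proof (induction p rule: frag_ind)
  case (of u)
  show ?case
  proof (induction q rule: frag_ind)
    case (of v)
    show ?case
    proof (cases "Lz \<in> set u \<union> set v")
      case True
      then have "Const (shuffle_word u v) = 0"
        by (intro Const_eq_0) (blast dest: keys_shuffle_word)
      then show ?thesis using True by auto
    next
      case False
      then have "Const (shuffle_word u v) = shuffle_word u v"
        by (intro Const_eq_id) (blast dest: keys_shuffle_word)
      then show ?thesis using False by auto
    qed
  qed (simp_all add: shuffle_diff_right)
qed (simp_all add: shuffle_diff_left)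

lemma Const_in_word_span: "p \<in> word_span W \<Longrightarrow> Const p \<in> word_span W"
  unfolding Const_def by (rule word_span_frag_extend) auto


section \<open>Shuffle regularization\<close>

text \<open>This condition guarantees that the coefficients of the expansion in shuffle powers of \<open>e\<^sub>1\<close>
  lie in \<open>Azm2\<close> and not only in \<open>Az0\<close>.\<close>

primrec zero_after_z :: "lword \<Rightarrow> bool" where
  "zero_after_z [] = True"
| "zero_after_z (a # w) = ((a = Lz \<longrightarrow> L0 \<in> set w) \<and> zero_after_z w)"

lemma zero_after_z_append: "zero_after_z (u @ v) \<Longrightarrow> zero_after_z v"
  by (induction u) auto

lemma zero_after_z_no_z: "Lz \<notin> set w \<Longrightarrow> zero_after_z w"
  by (induction w) auto

lemma zero_after_z_last_L0: "w = [] \<or> last w = L0 \<Longrightarrow> zero_after_z w"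
proof (induction w)
  case (Cons a w)
  then show ?case using last_in_set[of w] by (cases "w = []") auto
qed simp

lemma zero_after_z_shuffle_word:
  "zero_after_z u \<Longrightarrow> zero_after_z v \<Longrightarrow> w \<in> Poly_Mapping.keys (shuffle_word u v) \<Longrightarrow> zero_after_z w"
proof (induction u v arbitrary: w rule: shuffle_word.induct)
  case (3 a u b v)
  from 3(5) consider w' where "w = a # w'" "w' \<in> Poly_Mapping.keys (shuffle_word u (b # v))"
    | w' where "w = b # w'" "w' \<in> Poly_Mapping.keys (shuffle_word (a # u) v)"
    unfolding shuffle_word.simps by (meson in_keys_add in_keys_gen_mult)
  then show ?case
  proof cases
    case 1
    then show ?thesis using 3(1)[of w'] 3(3,4) keys_shuffle_word[OF 1(2)] by auto
  next
    case 2
    then show ?thesis using 3(2)[of w'] 3(3,4) keys_shuffle_word[OF 2(2)] by auto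
  qed
qed auto

lemma in_keys_stuffle_word_Cons:
  assumes "w \<in> Poly_Mapping.keys (stuffle_word (a # u) (b # v))"
  obtains w' where "w = label_mult a b # w'" "w' \<in> Poly_Mapping.keys (stuffle_word u (b # v))"
  | w' where "w = label_mult a b # w'" "w' \<in> Poly_Mapping.keys (stuffle_word (a # u) v)"
  | w' where "w = label_mult a b # L0 # w'" "w' \<in> Poly_Mapping.keys (stuffle_word u v)"
proof -
  obtain w' where w: "w = label_mult a b # w'"
    and w': "w' \<in> Poly_Mapping.keys (stuffle_word u (b # v) + stuffle_word (a # u) v - gen L0 * stuffle_word u v)"
    using in_keys_gen_mult[OF assms[unfolded stuffle_word.simps]] by blast
  consider "w' \<in> Poly_Mapping.keys (stuffle_word u (b # v))"
    | "w' \<in> Poly_Mapping.keys (stuffle_word (a # u) v)"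
    | "w' \<in> Poly_Mapping.keys (gen L0 * stuffle_word u v)"
    using in_keys_diff[OF w'] in_keys_add[of w' "stuffle_word u (b # v)" "stuffle_word (a # u) v"] by blast
  then show thesis
  proof cases
    case 3
    then obtain w'' where "w' = L0 # w''" "w'' \<in> Poly_Mapping.keys (stuffle_word u v)"
      using in_keys_gen_mult by blast
    with w that(3) show thesis by simp
  qed (use w that in simp_all)
qed

lemma zero_in_stuffle_word:
  "set u \<subseteq> {L0, L1} \<Longrightarrow> L0 \<in> set v \<Longrightarrow> w \<in> Poly_Mapping.keys (stuffle_word u v) \<Longrightarrow> L0 \<in> set w"
proof (induction u v arbitrary: w rule: stuffle_word.induct)
  case (3 a u b v)
  have u: "set u \<subseteq> {L0, L1}" using "3.prems" by simp
  \<comment> \<open>If the tail v has no e_0, then b itself is 0 and so is the product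
    label.\<close>
  have "label_mult a b = L0" if "L0 \<notin> set v" using that "3.prems" by auto
  with "3.prems"(3) show ?case
  proof (cases rule: in_keys_stuffle_word_Cons)
    case (1 w')
    then show ?thesis using "3.IH"(1)[OF u "3.prems"(2)] by simp
  next
    case (2 w')
    then show ?thesis using "3.IH"(2)[OF "3.prems"(1), of w'] \<open>L0 \<notin> set v \<Longrightarrow> _\<close>
      by (cases "L0 \<in> set v") auto
  qed simp
qed auto

text \<open>A leading e_z arises only from the label product of 1 with b = z. Then v contains an
  e_0, which by \<open>zero_in_stuffle_word\<close> survives in the remaining product; the third
  term of the recursion supplies an e_0 outright.\<close>

lemma zero_after_z_stuffle_word:
  "set u \<subseteq> {L0, L1} \<Longrightarrow> zero_after_z v \<Longrightarrow> w \<in> Poly_Mapping.keys (stuffle_word u v) \<Longrightarrow> zero_after_z w"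
proof (induction u v arbitrary: w rule: stuffle_word.induct)
  case (3 a u b v)
  have ab: "label_mult a b = Lz \<Longrightarrow> L0 \<in> set v" and u: "set u \<subseteq> {L0, L1}" "set (a # u) \<subseteq> {L0, L1}"
    using 3(4,5) by auto
  from 3(6) show ?case
  proof (cases rule: in_keys_stuffle_word_Cons)
    case (1 w')
    then show ?thesis
      using 3(1)[of w'] 3(5) u ab zero_in_stuffle_word[OF u(1) _ 1(2)] by auto
  next
    case (2 w')
    then show ?thesis
      using 3(2)[of w'] 3(5) u ab zero_in_stuffle_word[OF u(2) _ 2(2)] by auto
  next
    case (3 w')
    then show ?thesis
      using "3.IH"(3)[of w'] "3.prems" u by auto
  qed
qed (auto intro: zero_after_z_no_z)

definition reg_words :: "lword set"
  where "reg_words = {w. (w = [] \<or> hd w \<in> {L1, Lz}) \<and> zero_after_z w}"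

section \<open>Existence and uniqueness of expansions in shuffle powers of e_1\<close>

definition L1_expansion :: "nat \<Rightarrow> (nat \<Rightarrow> Az) \<Rightarrow> Az"
  where "L1_expansion n c = (\<Sum>i\<le>n. shuffle (c i) (gen L1 ^ i))"

lemma L1_expansion_diff:
  "L1_expansion n (\<lambda>i. c i - d i) = L1_expansion n c - L1_expansion n d"
  by (simp add: L1_expansion_def shuffle_diff_left sum_subtractf)

lemma L1_expansion_extend:
  assumes "m \<le> n"
  shows "L1_expansion n (\<lambda>i. if i \<le> m then c i else 0) = L1_expansion m c"
  unfolding L1_expansion_def
  by (rule sum.mono_neutral_cong_right) (use assms in auto)

text \<open>The lengths may differ, so that any expansion can be compared with the one of length
  \<open>word_deg\<close> in \<open>reg_sh\<close>; both are padded with zeros before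
  subtracting.\<close>

lemma L1_expansion_unique:
  assumes "\<And>i. i \<le> m \<Longrightarrow> c i \<in> not_ending_L1" "\<And>i. i \<le> n \<Longrightarrow> d i \<in> not_ending_L1"
    and "L1_expansion m c = L1_expansion n d"
  shows "c 0 = d 0"
proof -
  define e where "e i = (if i \<le> m then c i else 0) - (if i \<le> n then d i else 0)" for i
  have "L1_expansion (max m n) e = 0"
    unfolding e_def L1_expansion_diff by (simp add: L1_expansion_extend assms(3))
  moreover have "e i \<in> not_ending_L1" for i
    unfolding e_def not_ending_L1_def
    by (rule word_span_diff) (use assms(1,2)[of i] in \<open>auto simp: not_ending_L1_def\<close>)
  ultimately have "e 0 = 0"
    unfolding L1_expansion_def not_ending_L1_def by (intro shuffle_L1_powers_eq_0) auto
  then show ?thesis by (simp add: e_def)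
qed

lemma ex_L1_expansion_span:
  assumes "p \<in> word_span W" "\<And>w. w \<in> W \<Longrightarrow> \<exists>c. range c \<subseteq> Azm2 \<and> frag_of w = L1_expansion n c"
  shows "\<exists>c. range c \<subseteq> Azm2 \<and> p = L1_expansion n c"
  using assms(1)
proof (induction p rule: word_span_induct)
  case zero
  show ?case by (rule exI[of _ "\<lambda>_. 0"]) (auto simp: L1_expansion_def Azm2_0)
next
  case (of w)
  then show ?case by (rule assms(2))
next
  case (diff p q)
  then obtain c d where "range c \<subseteq> Azm2" "p = L1_expansion n c" "range d \<subseteq> Azm2" "q = L1_expansion n d"
    by blast
  then show ?case
    by (intro exI[of _ "\<lambda>i. c i - d i"]) (auto simp: L1_expansion_diff intro!: Azm2_diff)
qed

lemma trailing_L1: "\<exists>u k. w = u @ replicate k L1 \<and> (u = [] \<or> last u \<noteq> L1)"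
proof (induction w rule: rev_induct)
  case (snoc x w)
  then obtain u k where uk: "w = u @ replicate k L1" "u = [] \<or> last u \<noteq> L1" by blast
  show ?case
  proof (cases "x = L1")
    case True
    then have "w @ [x] = u @ replicate (Suc k) L1" by (simp add: uk replicate_append_same)
    then show ?thesis using uk by blast
  next
    case False
    then have "w @ [x] = (w @ [x]) @ replicate 0 L1 \<and> (w @ [x] = [] \<or> last (w @ [x]) \<noteq> L1)" by simp
    then show ?thesis by blast
  qed
qed simp

text \<open>Triangular elimination: if w is u followed by k letters e_1, then shuffling u with these
  letters gives w plus words with fewer trailing e_1, to which induction applies. Shuffling
  preserves length, so one bound n serves throughout.\<close>

lemma ex_L1_expansion_word:
  "w \<in> reg_words \<Longrightarrow> length w \<le> n \<Longrightarrow> \<exists>c. range c \<subseteq> Azm2 \<and> frag_of w = L1_expansion n c"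
proof (induction "tail_block {L1} w" arbitrary: w rule: less_induct)
  case less
  obtain u k where w: "w = u @ replicate k L1" and u: "u = [] \<or> last u \<noteq> L1"
    using trailing_L1 by blast
  have tb: "tail_block {L1} w = k"
    unfolding w by (subst tail_block_append) (use u in auto)
  \<comment> \<open>A last letter e_z of u would be followed only by letters e_1, against
    \<open>zero_after_z\<close>.\<close>
  have last_u: "u = [] \<or> last u = L0"
  proof (rule ccontr)
    assume "\<not> (u = [] \<or> last u = L0)"
    with u have "u \<noteq> []" "last u = Lz" by (metis letter.exhaust)+
    then have "w = butlast u @ Lz # replicate k L1"
      using append_butlast_last_id[of u] by (simp add: w)
    then show False
      using less.prems(1) zero_after_z_append[of "butlast u" "Lz # replicate k L1"]
      by (auto simp: reg_words_def)
  qed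
  then have uA: "frag_of u \<in> Azm2"
    using less.prems(1) by (auto simp: frag_of_Azm2 reg_words_def w)
  define r where "r = shuffle_word u (replicate k L1) - frag_of w"
  have keys: "w' \<in> reg_words \<and> length w' \<le> n \<and> tail_block {L1} w' < k" if w': "w' \<in> Poly_Mapping.keys r" for w'
  proof -
    have "tail_block {L1} w' < length (replicate k L1)"
      by (rule keys_shuffle_minus_append[of u]) (use u w' in \<open>auto simp: r_def w\<close>)
    then have tb': "tail_block {L1} w' < k" by simp
    then have "w' \<noteq> w" using tb by auto
    then have sh: "w' \<in> Poly_Mapping.keys (shuffle_word u (replicate k L1))"
      using in_keys_diff[of w'] w' unfolding r_def by fastforce
    have z: "zero_after_z u" "zero_after_z (replicate k L1)"
      using last_u by (auto intro: zero_after_z_no_z zero_after_z_last_L0)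
    have "w' = [] \<or> hd w' \<in> {L1, Lz}"
      using keys_shuffle_word[OF sh] sh less.prems(1)
      by (cases "u = []"; cases k) (auto simp: reg_words_def w)
    moreover have "length w' \<le> n"
      using keys_shuffle_word[OF sh] less.prems(2) by (simp add: w)
    ultimately show ?thesis
      using tb' zero_after_z_shuffle_word[OF z sh] by (simp add: reg_words_def)
  qed
  have "\<exists>c. range c \<subseteq> Azm2 \<and> r = L1_expansion n c"
  proof (rule ex_L1_expansion_span)
    show "r \<in> word_span (Poly_Mapping.keys r)" by (simp add: word_span_def)
    show "\<exists>c. range c \<subseteq> Azm2 \<and> frag_of w' = L1_expansion n c" if "w' \<in> Poly_Mapping.keys r" for w'
      using keys[OF that] less.hyps[of w'] tb by simp
  qed
  then obtain c where c: "range c \<subseteq> Azm2" "r = L1_expansion n c" by blast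
  \<comment> \<open>The leading part of the expansion: u as coefficient of the k-th power. The
    length bound on w guarantees that this power is present.\<close>
  define d where "d i = (if i = k then frag_of u else 0)" for i
  have "k \<le> n" using less.prems(2) by (simp add: w)
  then have "L1_expansion n d = shuffle_word u (replicate k L1)"
    unfolding L1_expansion_def d_def by (simp add: if_distrib[of "\<lambda>x. shuffle x _"] gen_power cong: if_cong)
  then have "frag_of w = L1_expansion n (\<lambda>i. d i - c i)"
    unfolding L1_expansion_diff by (simp add: r_def flip: c(2))
  moreover have "range (\<lambda>i. d i - c i) \<subseteq> Azm2"
    using c(1) uA by (auto simp: d_def Azm2_0 intro!: Azm2_diff)
  ultimately show ?case by blast
qed

lemma ex_L1_expansion:
  assumes "p \<in> word_span reg_words" "word_deg p \<le> n"
  shows "\<exists>c. range c \<subseteq> Azm2 \<and> p = L1_expansion n c"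
proof -
  have "length w \<le> n" if "w \<in> Poly_Mapping.keys p" for w
    using assms(2) that Max_ge[of "insert 0 (length ` Poly_Mapping.keys p)" "length w"]
    by (simp add: word_deg_def)
  then have "p \<in> word_span {w \<in> reg_words. length w \<le> n}"
    using assms(1) by (auto simp: word_span_def)
  then show ?thesis
    by (rule ex_L1_expansion_span) (auto intro: ex_L1_expansion_word)
qed


section \<open>Confluence of \<open>e\<^sub>z\<close> to \<open>e\<^sub>1\<close>\<close>

text \<open>An expansion of the length prescribed in \<open>reg_sh\<close> exists by elimination;
  uniqueness across lengths then lets any expansion over \<open>Azm2\<close> compute the
  regularization.\<close>

lemma reg_sh_eq:
  assumes p: "p \<in> word_span reg_words" and c: "range c \<subseteq> Azm2" and eq: "p = L1_expansion n c"
  shows "reg_sh p = c 0"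
proof -
  have Azm2_ne: "x \<in> not_ending_L1" if "x \<in> Azm2" for x
    using that Azm2_subset_Az0 Az0_subset_not_ending_L1 by blast
  obtain d where d: "range d \<subseteq> Azm2" "p = L1_expansion (word_deg p) d"
    using ex_L1_expansion[OF p order_refl] by blast
  have d0: "d 0 = c 0"
    by (rule L1_expansion_unique[of "word_deg p" d n c]) (use d c eq Azm2_ne in auto)
  show ?thesis
    unfolding reg_sh_def
  proof (rule the_equality)
    show "\<exists>c'. (\<forall>i\<le>word_deg p. c' i \<in> Az0) \<and> p = (\<Sum>i\<le>word_deg p. shuffle (c' i) (gen L1 ^ i)) \<and> c 0 = c' 0"
      using d d0 Azm2_subset_Az0 unfolding L1_expansion_def by (intro exI[of _ d]) auto
  next
    fix w0
    assume "\<exists>c'. (\<forall>i\<le>word_deg p. c' i \<in> Az0) \<and> p = (\<Sum>i\<le>word_deg p. shuffle (c' i) (gen L1 ^ i)) \<and> w0 = c' 0"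
    then obtain c' where c': "\<And>i. i \<le> word_deg p \<Longrightarrow> c' i \<in> Az0" "p = L1_expansion (word_deg p) c'" "w0 = c' 0"
      unfolding L1_expansion_def by blast
    have "c' 0 = c 0"
      by (rule L1_expansion_unique[of "word_deg p" c' n c])
        (use c' c eq Azm2_ne Az0_subset_not_ending_L1 in auto)
    then show "w0 = c 0" by (simp add: c'(3))
  qed
qed

section \<open>Compatibility of the substitution with both products\<close>

abbreviation z_to_1_letter :: "letter \<Rightarrow> letter"
  where "z_to_1_letter a \<equiv> (if a = Lz then L1 else a)"

lemma z_to_1_simps [simp]:
  "z_to_1 0 = 0" "z_to_1 (p - q) = z_to_1 p - z_to_1 q" "z_to_1 (p + q) = z_to_1 p + z_to_1 q"
  "z_to_1 (frag_of w) = frag_of (map z_to_1_letter w)"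
  by (simp_all add: z_to_1_def frag_extend_diff frag_extend_add)

lemma z_to_1_sum: "finite I \<Longrightarrow> z_to_1 (\<Sum>i\<in>I. f i) = (\<Sum>i\<in>I. z_to_1 (f i))"
  by (simp add: z_to_1_def frag_extend_sum comp_def)

lemma z_to_1_gen_mult: "z_to_1 (gen a * p) = gen (z_to_1_letter a) * z_to_1 p"
  by (induction p rule: frag_ind) (simp_all add: gen_mult_of right_diff_distrib)

lemma z_to_1_shuffle_word:
  "z_to_1 (shuffle_word u v) = shuffle_word (map z_to_1_letter u) (map z_to_1_letter v)"
  by (induction u v rule: shuffle_word.induct) (simp_all add: z_to_1_gen_mult)

lemma z_to_1_shuffle: "z_to_1 (shuffle p q) = shuffle (z_to_1 p) (z_to_1 q)"
proof (induction p rule: frag_ind)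
  case (of u)
  show ?case
    by (induction q rule: frag_ind) (simp_all add: z_to_1_shuffle_word shuffle_diff_right)
qed (simp_all add: shuffle_diff_left)

lemma z_to_1_stuffle_word:
  "set u \<subseteq> {L0, L1} \<Longrightarrow> z_to_1 (stuffle_word u v) = stuffle_word u (map z_to_1_letter v)"
proof (induction u v rule: stuffle_word.induct)
  case (2 a u)
  have "map z_to_1_letter (a # u) = a # u"
    by (rule map_idI) (use 2 in auto)
  then show ?case by simp
next
  case (3 a u b v)
  have "z_to_1_letter (label_mult a b) = label_mult a (z_to_1_letter b)"
    using 3(4) by auto
  then show ?case
    using 3 by (simp add: z_to_1_gen_mult)
qed simp

lemma z_to_1_no_z: "p \<in> free_on {L0, L1} \<Longrightarrow> z_to_1 p = p"
  unfolding free_on_def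
proof (induction p rule: word_span_induct)
  case (of w)
  then have "map z_to_1_letter w = w" by (intro map_idI) auto
  then show ?case by simp
qed simp_all

lemma z_to_1_Azm2:
  assumes "p \<in> Azm2"
  shows "z_to_1 p \<in> A0"
  using assms unfolding z_to_1_def Azm2_word_span A0_word_span
proof (rule word_span_frag_extend)
  fix w assume w: "w \<in> {u. u = [] \<or> hd u \<in> {L1, Lz} \<and> last u = L0}"
  have "set (map z_to_1_letter w) \<subseteq> {L0, L1}"
    using letter.exhaust by auto
  with w show "frag_of (map z_to_1_letter w)
      \<in> word_span {w. w = [] \<or> hd w = L1 \<and> last w = L0 \<and> set w \<subseteq> {L0, L1}}"
    by (cases "w = []") (auto simp: hd_map last_map simp del: set_map)
qed

lemma A0_subset_Azm2: "A0 \<subseteq> Azm2"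
  unfolding A0_word_span Azm2_word_span by (rule word_span_mono) auto

lemma A0_subset_free: "A0 \<subseteq> free_on {L0, L1}"
  unfolding A0_word_span free_on_def by (rule word_span_mono) auto

text \<open>The counterpart of \<open>I_ST\<close> before shuffle regularization.\<close>

definition st_reg :: "Az set"
  where "st_reg = {x \<in> word_span reg_words. \<forall>as \<in> lists {L0, L1}. Const (foldr (del Lz) as x) = 0}"

lemma st_reg_0: "0 \<in> st_reg"
  by (simp add: st_reg_def foldr_del_0)

lemma st_reg_diff: "x \<in> st_reg \<Longrightarrow> y \<in> st_reg \<Longrightarrow> x - y \<in> st_reg"
  by (simp add: st_reg_def foldr_del_diff word_span_diff)

lemma foldr_del_not_ending_L1: "p \<in> not_ending_L1 \<Longrightarrow> foldr (del Lz) as p \<in> not_ending_L1"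
  by (induction as) (simp_all add: del_not_ending_L1)

lemma gen_L1_power_free: "gen L1 ^ i \<in> free_on {L0, L1}"
  by (auto simp: gen_power free_on_def)

text \<open>Powers of e_1 contain no e_z, so derivatives, \<open>Const\<close> and the substitution
  all act on the coefficients of an expansion of x. The first two give an expansion of 0, hence
  \<open>c 0\<close> is a standard relation; the third gives an expansion of \<open>z_to_1 x\<close>
  with constant coefficient \<open>z_to_1 (c 0)\<close>.\<close>

lemma reg_sh_z_to_1_st_reg:
  assumes "x \<in> st_reg"
  shows "reg_sh (z_to_1 x) \<in> z_to_1 ` (I_ST \<inter> Azm2)"
proof -
  have x: "x \<in> word_span reg_words" using assms by (simp add: st_reg_def)
  obtain n c where c: "range c \<subseteq> Azm2" and x_eq: "x = L1_expansion n c"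
    using ex_L1_expansion[OF x order_refl] by blast
  have "c 0 \<in> I_ST"
    unfolding I_ST_def
  proof (intro CollectI conjI ballI)
    show "c 0 \<in> Az0" using c Azm2_subset_Az0 by auto
    fix as assume as: "as \<in> lists {L0, L1}"
    define e where "e i = Const (foldr (del Lz) as (c i))" for i
    have "L1_expansion n e = Const (foldr (del Lz) as x)"
    proof -
      have "Const (gen L1 ^ i) = gen L1 ^ i" for i
        by (simp add: gen_power)
      then show ?thesis
        unfolding x_eq L1_expansion_def e_def
        by (simp add: foldr_del_sum foldr_del_shuffle_no_z[OF gen_L1_power_free] Const_sum Const_shuffle)
    qed
    also have "\<dots> = L1_expansion 0 (\<lambda>_. 0)"
      using assms as by (simp add: st_reg_def L1_expansion_def)
    finally have "e 0 = 0"
    proof (rule L1_expansion_unique[rotated 2])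
      \<comment> \<open>Derivatives of the coefficients may leave \<open>Azm2\<close>, so uniqueness
        is applied in the larger stable class.\<close>
      have "c i \<in> not_ending_L1" for i
        using c Azm2_subset_Az0 Az0_subset_not_ending_L1 by blast
      then show "e i \<in> not_ending_L1" for i
        unfolding e_def using foldr_del_not_ending_L1 Const_in_word_span
        by (metis not_ending_L1_def)
    qed (simp add: not_ending_L1_def)
    then show "Const (foldr (del Lz) as (c 0)) = 0" by (simp add: e_def)
  qed
  moreover have "reg_sh (z_to_1 x) = z_to_1 (c 0)"
  proof (rule reg_sh_eq)
    show "z_to_1 x \<in> word_span reg_words"
      unfolding z_to_1_def
    proof (rule word_span_frag_extend[OF x])
      fix w assume w: "w \<in> reg_words"
      have "zero_after_z (map z_to_1_letter w)"
        by (rule zero_after_z_no_z) auto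
      then show "frag_of (map z_to_1_letter w) \<in> word_span reg_words"
        using w by (cases w) (auto simp: reg_words_def)
    qed
    show "range (\<lambda>i. z_to_1 (c i)) \<subseteq> Azm2"
      using c z_to_1_Azm2 A0_subset_Azm2 by blast
    have "z_to_1 (gen L1 ^ i) = gen L1 ^ i" for i
      by (rule z_to_1_no_z[OF gen_L1_power_free])
    then show "z_to_1 x = L1_expansion n (\<lambda>i. z_to_1 (c i))"
      by (simp add: x_eq L1_expansion_def z_to_1_sum z_to_1_shuffle)
  qed
  ultimately show ?thesis using c by blast
qed

section \<open>Double shuffle defects of lifted elements\<close>

lemma stuffle_diff_left: "stuffle (p - q) r = stuffle p r - stuffle q r"
  by (simp add: stuffle_def bilinear_ext_def frag_extend_diff)

lemma stuffle_diff_right: "stuffle r (p - q) = stuffle r p - stuffle r q"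
  by (simp add: stuffle_def bilinear_ext_def frag_extend_diff frag_extend_diff_fun)

lemma stuffle_0 [simp]: "stuffle 0 r = 0" "stuffle r 0 = 0"
  using stuffle_diff_left[of 0 0 r] stuffle_diff_right[of r 0 0] by simp_all

definition A1_words :: "lword set"
  where "A1_words = {u. (u = [] \<or> hd u = L1) \<and> set u \<subseteq> {L0, L1}}"

lemma A1_word_span: "A1 = word_span A1_words"
proof -
  have "{[]} \<union> {L1 # m |m. m \<in> lists {L0, L1}} = A1_words"
  proof (rule Set.set_eqI)
    fix w :: lword
    show "w \<in> {[]} \<union> {L1 # m |m. m \<in> lists {L0, L1}} \<longleftrightarrow> w \<in> A1_words"
      by (cases w) (auto simp: A1_words_def)
  qed
  then show ?thesis by (simp only: A1_def)
qed

lemma del_stuffle: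
  assumes "\<alpha> \<in> {L0, L1}" "u \<in> A1_words" "q \<in> word_span z_words"
  shows "del Lz \<alpha> (stuffle_left u q) = stuffle_left u (del Lz \<alpha> q)"
  using assms(3)
proof (induction q rule: word_span_induct)
  case (of v)
  then show ?case
    using assms(1,2) by (simp add: del_stuffle_word A1_words_def z_words_def)
qed simp_all

text \<open>The claims are proved together: a further derivative passes through the stuffle product
  because the derivative of q reached so far is still in the span of \<open>z_words\<close>.\<close>

lemma foldr_del_double_shuffle:
  assumes "as \<in> lists {L0, L1}" "u \<in> A1_words" "q \<in> word_span z_words"
  shows "foldr (del Lz) as q \<in> word_span z_words"
    and "foldr (del Lz) as (shuffle (frag_of u) q - stuffle_left u q) =
         shuffle (frag_of u) (foldr (del Lz) as q) - stuffle_left u (foldr (del Lz) as q)"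
  using assms(1)
proof (induction as)
  case (Cons \<alpha> as)
  have u: "del_word Lz \<alpha> u = 0"
    using assms(2) by (intro del_word_no_z) (auto simp: A1_words_def)
  {
    case 1
    then show ?case using Cons by (simp add: del_z_words)
  next
    case 2
    then show ?case using Cons assms(2) u by (simp add: del_shuffle del_stuffle)
  }
qed (use assms(3) in simp_all)

text \<open>For empty v the defect itself is zero. Otherwise v begins with e_z, which occurs in
  every word of the shuffle; a stuffle of nonempty words begins with the label product of 1 and z,
  again e_z.\<close>

lemma Const_double_shuffle:
  assumes u: "u \<in> A1_words" and "q \<in> word_span z_words"
  shows "Const (shuffle (frag_of u) q - stuffle_left u q) = 0"
  using assms(2)
proof (induction q rule: word_span_induct)
  case (of v)
  show ?case
  proof (cases "v = []")
    case True
    then show ?thesis by simp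
  next
    case False
    then obtain v' where v: "v = Lz # v'" using of by (cases v) (auto simp: z_words_def)
    have "Const (shuffle (frag_of u) (frag_of v)) = 0"
      unfolding Const_shuffle by (simp add: v)
    moreover have "Lz \<in> set w" if "w \<in> Poly_Mapping.keys (stuffle_word u v)" for w
    proof (cases u)
      case Nil
      then show ?thesis using that v by simp
    next
      case (Cons a u')
      then have "a = L1" using u by (simp add: A1_words_def)
      then show ?thesis
        using that unfolding v Cons by (elim in_keys_stuffle_word_Cons) auto
    qed
    then have "Const (stuffle_word u v) = 0" by (rule Const_eq_0)
    ultimately show ?thesis by simp
  qed
qed (simp_all add: shuffle_diff_right)

text \<open>The added condition places the defects in the span of \<open>reg_words\<close>.\<close>

definition z_lift_words :: "lword set"
  where "z_lift_words = {v \<in> z_words. zero_after_z v}"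

lemma double_shuffle_word_st_reg:
  assumes u: "u \<in> A1_words" and v: "v \<in> z_lift_words"
  shows "shuffle_word u v - stuffle_word u v \<in> st_reg"
proof -
  have v': "v \<in> z_words" "zero_after_z v" using v by (auto simp: z_lift_words_def)
  have u': "set u \<subseteq> {L0, L1}" "zero_after_z u"
    using u by (auto simp: A1_words_def intro!: zero_after_z_no_z)
  have hd_u: "u = [] \<or> hd u = L1" and hd_v: "v = [] \<or> hd v = Lz"
    using u v' by (auto simp: A1_words_def z_words_def)
  have "w \<in> reg_words" if w: "w \<in> Poly_Mapping.keys (shuffle_word u v)" for w
  proof -
    have "w = [] \<or> hd w \<in> {L1, Lz}"
      using keys_shuffle_word[OF w] w hd_u hd_v by (cases "u = []"; cases "v = []") auto
    then show ?thesis
      using zero_after_z_shuffle_word[OF u'(2) v'(2) w] by (simp add: reg_words_def)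
  qed
  moreover have "w \<in> reg_words" if w: "w \<in> Poly_Mapping.keys (stuffle_word u v)" for w
  proof -
    have "w = [] \<or> hd w \<in> {L1, Lz}"
    proof (cases "u = [] \<or> v = []")
      case True
      then show ?thesis using w hd_u hd_v by auto
    next
      case False
      then obtain a x b y where ab: "u = a # x" "v = b # y" by (meson list.exhaust)
      then have "a = L1" "b = Lz" using hd_u hd_v by auto
      then show ?thesis using w unfolding ab by (elim in_keys_stuffle_word_Cons) auto
    qed
    then show ?thesis
      using zero_after_z_stuffle_word[OF u'(1) v'(2) w] by (simp add: reg_words_def)
  qed
  ultimately have "shuffle_word u v - stuffle_word u v \<in> word_span reg_words"
    by (intro word_span_diff) (auto simp: word_span_def)
  moreover have "Const (foldr (del Lz) as (shuffle_word u v - stuffle_word u v)) = 0"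
    if "as \<in> lists {L0, L1}" for as
    using foldr_del_double_shuffle[OF that u, of "frag_of v"] Const_double_shuffle[OF u] v'(1)
    by (simp del: Const_simps)
  ultimately show ?thesis by (simp add: st_reg_def)
qed

lemma double_shuffle_st_reg:
  assumes "u \<in> A1" "v \<in> word_span z_lift_words"
  shows "shuffle u v - stuffle u v \<in> st_reg"
  using assms(1) unfolding A1_word_span
proof (induction u rule: word_span_induct)
  case (of u)
  show ?case
    using assms(2)
  proof (induction v rule: word_span_induct)
    case (of v)
    then show ?case using \<open>u \<in> A1_words\<close> by (simp add: double_shuffle_word_st_reg)
  next
    case (diff p q)
    then show ?case
      using st_reg_diff[OF diff] by (simp add: shuffle_diff_right algebra_simps)
  qed (simp add: st_reg_0)
next
  case (diff p q)
  then show ?case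
    using st_reg_diff[OF diff] by (simp add: shuffle_diff_left stuffle_diff_left algebra_simps)
qed (simp add: st_reg_0)

lemma z_to_1_stuffle:
  assumes "u \<in> free_on {L0, L1}"
  shows "z_to_1 (stuffle u v) = stuffle u (z_to_1 v)"
  using assms unfolding free_on_def
proof (induction u rule: word_span_induct)
  case (of u)
  then have "set u \<subseteq> {L0, L1}" by auto
  then show ?case
    by (induction v rule: frag_ind) (simp_all add: z_to_1_stuffle_word)
qed (simp_all add: stuffle_diff_left)

lemma A0_lift_z:
  assumes "v \<in> A0"
  obtains v' where "v' \<in> word_span z_lift_words" "z_to_1 v' = v"
proof -
  have "\<exists>v' \<in> word_span z_lift_words. z_to_1 v' = v"
    using assms unfolding A0_word_span
  proof (induction v rule: word_span_induct)
    case (of w)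
    define w' where "w' = map (\<lambda>a. if a = L1 then Lz else a) w"
    have "map z_to_1_letter w' = w"
      unfolding w'_def map_map by (rule map_idI) (use of in auto)
    \<comment> \<open>A nonempty w in \<open>A0\<close> ends in e_0, and this letter is kept in
      w'.\<close>
    moreover have "zero_after_z w'"
      by (rule zero_after_z_last_L0) (use of in \<open>cases "w = []"; auto simp: w'_def last_map\<close>)
    moreover have "(w' = [] \<or> hd w' = Lz) \<and> set w' \<subseteq> {L0, Lz}"
      using of by (cases w) (auto simp: w'_def)
    ultimately show ?case
      by (intro bexI[of _ "frag_of w'"]) (simp_all add: z_lift_words_def z_words_def)
  next
    case (diff p q)
    then show ?case by (metis word_span_diff z_to_1_simps(2))
  qed (auto intro: bexI[of _ 0])
  then show thesis using that by blast
qed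

section \<open>The ideal of substituted standard relations\<close>

lemma I_ST_diff: "p \<in> I_ST \<Longrightarrow> q \<in> I_ST \<Longrightarrow> p - q \<in> I_ST"
  by (simp add: I_ST_def Az0_def word_span_diff foldr_del_diff)

lemma I_ST_0: "0 \<in> I_ST"
  by (simp add: I_ST_def Az0_def foldr_del_0)

text \<open>The iterated derivatives of the product are those of w shuffled with a, and
  \<open>Const\<close> is multiplicative for the shuffle.\<close>

lemma I_ST_shuffle_A0:
  assumes "w \<in> I_ST" "w \<in> Azm2" "a \<in> A0"
  shows "shuffle w a \<in> I_ST"
proof -
  have "shuffle w a \<in> Az0"
    using Azm2_shuffle_A0[OF assms(2,3)] Azm2_subset_Az0 by blast
  moreover have "a \<in> free_on {L0, L1}" using assms(3) A0_subset_free by blast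
  ultimately show ?thesis
    using assms(1) by (simp add: I_ST_def foldr_del_shuffle_no_z Const_shuffle)
qed

lemma ideal_z_to_1_I_ST: "ideal (z_to_1 ` (I_ST \<inter> Azm2)) shuffle_ring" (is "ideal ?J _")
proof -
  interpret cring shuffle_ring by (rule cring_shuffle_ring)
  have carrier: "carrier shuffle_ring = A0" by (simp add: shuffle_ring_def)
  have J_A0: "?J \<subseteq> A0" using z_to_1_Azm2 by blast
  have J_0: "0 \<in> ?J" using I_ST_0 Azm2_0 by (intro image_eqI[of _ _ 0]) auto
  have J_diff: "x - y \<in> ?J" if "x \<in> ?J" "y \<in> ?J" for x y
  proof -
    from that obtain p q where "x = z_to_1 p" "y = z_to_1 q" "p \<in> I_ST \<inter> Azm2" "q \<in> I_ST \<inter> Azm2" by blast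
    then show ?thesis
      by (intro image_eqI[of _ _ "p - q"]) (auto simp: I_ST_diff Azm2_diff)
  qed
  \<comment> \<open>The substitution fixes a, so multiplication by a lifts to a shuffle with a
    inside \<open>I_ST \<inter> Azm2\<close>.\<close>
  have J_shuffle: "shuffle x a \<in> ?J" if "x \<in> ?J" "a \<in> A0" for x a
  proof -
    from that obtain p where p: "x = z_to_1 p" "p \<in> I_ST \<inter> Azm2" by blast
    have "z_to_1 a = a" using that A0_subset_free by (intro z_to_1_no_z) auto
    then show ?thesis
      using p that(2) by (intro image_eqI[of _ _ "shuffle p a"])
        (auto simp: z_to_1_shuffle I_ST_shuffle_A0 Azm2_shuffle_A0)
  qed
  have J_uminus: "- y \<in> ?J" if "y \<in> ?J" for y
    using J_diff[OF J_0 that] by simp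
  show ?thesis
  proof (rule idealI)
    show "subgroup ?J (add_monoid shuffle_ring)"
    proof (rule add.subgroupI)
      show "?J \<subseteq> carrier shuffle_ring" using J_A0 carrier by simp
      show "?J \<noteq> {}" using J_0 by blast
      show "\<ominus>\<^bsub>shuffle_ring\<^esub> x \<in> ?J" if x: "x \<in> ?J" for x
      proof -
        have "\<ominus>\<^bsub>shuffle_ring\<^esub> x = - x"
          by (rule minus_equality) (use J_A0 x J_uminus[OF x] in \<open>auto simp: shuffle_ring_def\<close>)
        then show ?thesis using J_uminus[OF x] by simp
      qed
      show "x \<oplus>\<^bsub>shuffle_ring\<^esub> y \<in> ?J" if "x \<in> ?J" "y \<in> ?J" for x y
        using J_diff[OF that(1) J_uminus[OF that(2)]] by (simp add: shuffle_ring_def)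
    qed
  next
    show "x \<otimes>\<^bsub>shuffle_ring\<^esub> a \<in> ?J" "a \<otimes>\<^bsub>shuffle_ring\<^esub> x \<in> ?J"
      if "a \<in> ?J" "x \<in> carrier shuffle_ring" for a x
      using J_shuffle[of a x] that shuffle_comm[of x a] by (simp_all add: shuffle_ring_def)
  qed (rule ring_axioms)
qed

theorem theorem26:
  shows "I_RDS \<subseteq> I_CF"
proof -
  have "reg_sh (shuffle u v - stuffle u v) \<in> z_to_1 ` (I_ST \<inter> Azm2)" if u: "u \<in> A1" and v: "v \<in> A0" for u v
  proof -
    obtain v' where v': "v' \<in> word_span z_lift_words" "z_to_1 v' = v"
      using A0_lift_z[OF v] .
    have u_free: "u \<in> free_on {L0, L1}"
      using u unfolding A1_word_span free_on_def
      by (rule subsetD[OF word_span_mono, rotated]) (auto simp: A1_words_def)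
    have "z_to_1 (shuffle u v' - stuffle u v') = shuffle u v - stuffle u v"
      by (simp add: z_to_1_shuffle z_to_1_stuffle[OF u_free] z_to_1_no_z[OF u_free] v'(2))
    then show ?thesis
      using reg_sh_z_to_1_st_reg[OF double_shuffle_st_reg[OF u v'(1)]] by simp
  qed
  \<comment> \<open>The right-hand side is an ideal containing all generators, hence contains the
    ideal they generate.\<close>
  then have "I_RDS \<subseteq> z_to_1 ` (I_ST \<inter> Azm2)"
    unfolding I_RDS_def
    by (intro ring.genideal_minimal[OF cring.axioms(1)[OF cring_shuffle_ring] ideal_z_to_1_I_ST]) auto
  also have "\<dots> \<subseteq> I_CF"
    unfolding I_CF_def by (auto simp: conf_lambda_Azm2 intro!: image_eqI)
  finally show ?thesis .
qed

end
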